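(* Let $G=(V,E)$ be a multigraph with $m$ edges (loops counted) and rank $r=|V|-c(E)$. Then $$h^\ast(\mathcal C_G;z)=(1+z)^{m-r}(2z)^r\,T_G\!\left(\frac{1+3z}{2z},\,1\right).$$
   Context: For a finite undirected multigraph $G=(V,E)$ (loops, parallel edges and isolated nodes allowed) with $n=|V|$, $m=|E|$, work in $\mathbb{R}^V\times\mathbb{R}^E\cong\mathbb{R}^{n+m}$ with standard basis vectors $e_u$, $e_f$. For each edge $f$ with endpoints $u,v$ ($u=v$ for a loop) set $\widetilde e_f=e_u+e_v-e_f$, $\overleftarrow e_f=e_u-e_v+e_f$, $\overrightarrow e_f=-e_u+e_v+e_f$. The cosmological polytope $\mathcal C_G$ is the convex hull of $\{e_f,\widetilde e_f,\overleftarrow e_f,\overrightarrow e_f: f\in E\}\cup\{e_u: u\in V\}$, a lattice polytope of dimension $n+m-1$. For a $d$-dimensional lattice polytope $P\subseteq\mathbb{R}^N$, the $h^\ast$-polynomial is defined by $\sum_{j\ge0}|jP\cap\mathbb{Z}^N|z^j=h^\ast(P;z)/(1-z)^{d+1}$. For $H\subseteq E$, $c(H)$ is the number of connected components of the graph $(V,H)$ (isolated nodes count as components). The Tutte polynomial is $T_G(x,y)=\sum_{H\subseteq E}(x-1)^{c(H)-c(E)}(y-1)^{c(H)+|H|-|V|}$. *)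

theory Defs
  imports "HOL-Analysis.Analysis" "HOL-Computational_Algebra.Formal_Laurent_Series"
begin

text \<open>A finite multigraph: vertex set = UNIV of the finite type 'v, edge set = a subset E of the
finite type 'e (so E may be empty), and ends f = (u,v) gives the two endpoints of edge f \<in> E (u = v for a loop).
Points of R^V x R^E are vectors indexed by 'v + 'e (Inl u, Inr f); coordinates Inr f with f \<notin> E are identically 0 on the polytope.\<close>

definition unitv :: "'i::finite \<Rightarrow> real ^ 'i" where
  "unitv i = (\<chi> j. if j = i then 1 else 0)"

definition cosmo_points :: "'e::finite set \<Rightarrow> ('e \<Rightarrow> 'v::finite \<times> 'v) \<Rightarrow> (real ^ ('v + 'e)) set" where
  "cosmo_points E ends =
     (\<Union>f\<in>E. let u = fst (ends f); v = snd (ends f) in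
        { unitv (Inr f),
          unitv (Inl u) + unitv (Inl v) - unitv (Inr f),
          unitv (Inl u) - unitv (Inl v) + unitv (Inr f),
          - unitv (Inl u) + unitv (Inl v) + unitv (Inr f) })
     \<union> (\<lambda>u. unitv (Inl u)) ` UNIV"

definition cosmological_polytope :: "'e::finite set \<Rightarrow> ('e \<Rightarrow> 'v::finite \<times> 'v) \<Rightarrow> (real ^ ('v + 'e)) set" where
  "cosmological_polytope E ends = convex hull (cosmo_points E ends)"

definition lattice_points :: "(real ^ 'i::finite) set \<Rightarrow> (real ^ 'i) set" where
  "lattice_points P = {x \<in> P. \<forall>i. x $ i \<in> \<int>}"

text \<open>Ehrhart series  sum_j |jP \<inter> Z^N| z^j  as a formal power series.\<close>
definition ehrhart_series :: "(real ^ 'i::finite) set \<Rightarrow> real fps" where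
  "ehrhart_series P = Abs_fps (\<lambda>j. real (card (lattice_points ((\<lambda>x. real j *\<^sub>R x) ` P))))"

text \<open>h*-polynomial of a lattice polytope of dimension d: h*(z) = (1-z)^(d+1) * Ehrhart series.\<close>
definition h_star :: "(real ^ 'i::finite) set \<Rightarrow> real fps" where
  "h_star P = ehrhart_series P * (1 - fps_X) ^ nat (aff_dim P + 1)"

text \<open>Number of connected components of the spanning subgraph (V,H).\<close>
definition edge_rel :: "('e \<Rightarrow> 'v \<times> 'v) \<Rightarrow> 'e set \<Rightarrow> ('v \<times> 'v) set" where
  "edge_rel ends H = {(u, v). \<exists>f\<in>H. ends f = (u, v) \<or> ends f = (v, u)}"

definition num_components :: "('e \<Rightarrow> 'v \<times> 'v) \<Rightarrow> 'e set \<Rightarrow> nat" where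
  "num_components ends H = card (UNIV // ((edge_rel ends H)\<^sup>*))"

text \<open>Tutte polynomial T_G(x,y) evaluated in a field (both exponents are nonnegative integers,
so nat subtraction is exact).\<close>
definition tutte :: "'e::finite set \<Rightarrow> ('e \<Rightarrow> 'v::finite \<times> 'v) \<Rightarrow> 'a::field \<Rightarrow> 'a \<Rightarrow> 'a" where
  "tutte E ends x y = (\<Sum>H\<in>Pow E.
      (x - 1) ^ (num_components ends H - num_components ends E)
    * (y - 1) ^ (num_components ends H + card H - CARD('v)))"

definition graph_rank :: "'e::finite set \<Rightarrow> ('e \<Rightarrow> 'v::finite \<times> 'v) \<Rightarrow> nat" where
  "graph_rank E ends = CARD('v) - num_components ends E"

end

theory Submission
  imports Defs
begin

text \<open>
Put \<open>D = y + \<Sum>f. c f (e_u + e_v)\<close> for a point \<open>(y, c)\<close> of \<open>\<real>^V \<times> \<real>^E\<close>. In the coordinates \<open>(D, c)\<close> the cone over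
the polytope is described by \<open>D(S) \<ge> \<Sum>{2 max (c f) 0 | f inside S}\<close> for all \<open>S \<subseteq> V\<close>; these inequalities
are sufficient by an uncrossing argument, which distributes the demand of each edge over its two ends.
For fixed \<open>c\<close>, adding a non-loop \<open>f = uv\<close> of demand \<open>N\<close> thickens the set of integral solutions \<open>D\<close> by a
segment of lattice length \<open>N\<close> in direction \<open>e_u - e_v\<close>. As the fibres in this direction are intervals, indexed
by the solutions for the contraction \<open>G/f\<close>, the number of solutions grows by \<open>N\<close> times their number for
\<open>G/f\<close>. Summing over \<open>c f\<close>, the Ehrhart series satisfies
\<open>Ehr(G + f) = (1+z)/(1-z) Ehr(G) + 2z/(1-z)^2 Ehr(G/f)\<close>, whence
\<open>h* = \<Sum>{(2z)^|H| (1+z)^(m-|H|) | H forest}\<close>; this is the Tutte evaluation, since at \<open>y = 1\<close> only forests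
contribute.
\<close>

section \<open>Demands on edges\<close>

lemma sum_of_bool_mult:
  fixes c :: "'a \<Rightarrow> 'b::semiring_1"
  assumes "finite A"
  shows "(\<Sum>x\<in>A. c x * of_bool (x = y)) = c y * of_bool (y \<in> A)"
  using assms sum.delta[of A y c] by (simp add: of_bool_def if_distrib cong: if_cong)

definition inner_edges :: "'e set \<Rightarrow> ('e \<Rightarrow> 'v \<times> 'v) \<Rightarrow> 'v set \<Rightarrow> 'e set" where
  "inner_edges E ends S = {f\<in>E. fst (ends f) \<in> S \<and> snd (ends f) \<in> S}"

text \<open>A Hall-type condition with \<open>N\<close> as demand of the edges and \<open>D\<close>
  as supply at the vertices. The ring is left general because the polytope uses it over the reals
  and its lattice points use it over the integers.\<close>

definition dominates ::
  "'v set \<Rightarrow> 'e set \<Rightarrow> ('e \<Rightarrow> 'v \<times> 'v) \<Rightarrow> ('e \<Rightarrow> 'a) \<Rightarrow> ('v \<Rightarrow> 'a::linordered_idom) \<Rightarrow> bool" where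
  "dominates V E ends N D \<longleftrightarrow> (\<forall>S\<subseteq>V. sum N (inner_edges E ends S) \<le> sum D S)"

text \<open>The amounts may be negative: \<open>take_edge (u, v) t (- t)\<close> moves
  \<open>t\<close> from \<open>u\<close> to \<open>v\<close>, and opposite amounts undo each other.
  At a loop both amounts are taken from the same vertex.\<close>

definition take_edge :: "'v \<times> 'v \<Rightarrow> 'a \<Rightarrow> 'a \<Rightarrow> ('v \<Rightarrow> 'a) \<Rightarrow> 'v \<Rightarrow> 'a::linordered_idom" where
  "take_edge p a b D = (\<lambda>w. D w - a * of_bool (w = fst p) - b * of_bool (w = snd p))"

lemma inner_edges_subset: "inner_edges E ends S \<subseteq> E"
  by (auto simp: inner_edges_def)

lemma finite_inner_edges [simp]: "finite E \<Longrightarrow> finite (inner_edges E ends S)"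
  by (simp add: inner_edges_def)

lemma inner_edges_empty [simp]: "inner_edges {} ends S = {}" "inner_edges E ends {} = {}"
  by (auto simp: inner_edges_def)

lemma sum_inner_edges_insert:
  fixes N :: "'e \<Rightarrow> 'a::linordered_idom"
  assumes "finite E" "f \<notin> E"
  shows "sum N (inner_edges (insert f E) ends S) =
    sum N (inner_edges E ends S) + N f * of_bool (fst (ends f) \<in> S \<and> snd (ends f) \<in> S)"
proof (cases "fst (ends f) \<in> S \<and> snd (ends f) \<in> S")
  case True
  then have "inner_edges (insert f E) ends S = insert f (inner_edges E ends S)"
    by (auto simp: inner_edges_def)
  moreover have "f \<notin> inner_edges E ends S" using assms by (auto simp: inner_edges_def)
  ultimately show ?thesis using True assms by simp
next
  case False
  then have "inner_edges (insert f E) ends S = inner_edges E ends S"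
    by (auto simp: inner_edges_def)
  then show ?thesis using False by auto
qed

lemma sum_take_edge:
  fixes D :: "'v \<Rightarrow> 'a::linordered_idom"
  assumes "finite S"
  shows "sum (take_edge p a b D) S = sum D S - a * of_bool (fst p \<in> S) - b * of_bool (snd p \<in> S)"
  unfolding take_edge_def by (simp add: sum_subtractf sum_of_bool_mult assms)

text \<open>The edges inside both sets are those inside the intersection, while an edge between
  \<open>S - T\<close> and \<open>T - S\<close> is inside the union only, where its nonnegative
  demand lowers the slack.\<close>

lemma slack_submodular:
  fixes N :: "'e \<Rightarrow> 'a::linordered_idom"
  assumes "finite E" "finite S" "finite T" and nn: "\<And>f. f \<in> E \<Longrightarrow> 0 \<le> N f"
  shows "(sum D (S \<union> T) - sum N (inner_edges E ends (S \<union> T)))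
       + (sum D (S \<inter> T) - sum N (inner_edges E ends (S \<inter> T)))
      \<le> (sum D S - sum N (inner_edges E ends S)) + (sum D T - sum N (inner_edges E ends T))"
proof -
  have "sum N (inner_edges E ends S) + sum N (inner_edges E ends T)
      = sum N (inner_edges E ends S \<union> inner_edges E ends T)
      + sum N (inner_edges E ends S \<inter> inner_edges E ends T)"
    using assms by (simp add: sum.union_inter)
  also have "inner_edges E ends S \<inter> inner_edges E ends T = inner_edges E ends (S \<inter> T)"
    by (auto simp: inner_edges_def)
  also have "sum N (inner_edges E ends S \<union> inner_edges E ends T) \<le> sum N (inner_edges E ends (S \<union> T))"
    by (rule sum_mono2) (use assms in \<open>auto simp: inner_edges_def\<close>)
  finally have "sum N (inner_edges E ends S) + sum N (inner_edges E ends T)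
     \<le> sum N (inner_edges E ends (S \<union> T)) + sum N (inner_edges E ends (S \<inter> T))" by simp
  moreover have "sum D (S \<union> T) + sum D (S \<inter> T) = sum D S + sum D T"
    using assms by (simp add: sum.union_inter)
  ultimately show ?thesis by (simp add: algebra_simps)
qed

text \<open>Uncrossing: were the choice of \<open>a\<close> obstructed by a set \<open>S\<close> containing only \<open>u\<close> and a set \<open>T\<close>
containing only \<open>v\<close>, the inequality for \<open>S \<union> T\<close>, which contains the edge \<open>f\<close>, would fail.\<close>

lemma dominates_insertE:
  fixes N :: "'e \<Rightarrow> 'a::linordered_idom"
  assumes fin: "finite V" "finite E" "f \<notin> E" and V: "fst (ends f) \<in> V" "snd (ends f) \<in> V"
    and nn: "\<And>g. g \<in> insert f E \<Longrightarrow> 0 \<le> N g"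
    and dom: "dominates V (insert f E) ends N D"
  obtains a where "0 \<le> a" "a \<le> N f" "dominates V E ends N (take_edge (ends f) a (N f - a) D)"
proof -
  define u where "u = fst (ends f)"
  define v where "v = snd (ends f)"
  define slack where "slack S = sum D S - sum N (inner_edges E ends S)" for S
  have slack: "N f * of_bool (u \<in> S \<and> v \<in> S) \<le> slack S" if "S \<subseteq> V" for S
    using dom that by (simp add: dominates_def sum_inner_edges_insert fin slack_def u_def v_def algebra_simps)
  have nn0: "0 \<le> slack S" if "S \<subseteq> V" for S
    using slack[OF that] nn[of f] by (auto simp: of_bool_def split: if_splits)
  define \<A> where "\<A> = {S. S \<subseteq> V \<and> u \<in> S \<and> v \<notin> S}"
  have finA: "finite \<A>" using fin by (simp add: \<A>_def)
  \<comment> \<open>The largest share of \<open>N f\<close> that \<open>u\<close> can bear, since a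
    set with \<open>u\<close> but not \<open>v\<close> loses the whole share from its slack. If
    \<open>a\<close> is below \<open>N f\<close>, it is the slack of some set in
    \<open>\<A>\<close>.\<close>
  define a where "a = Min (insert (N f) (slack ` \<A>))"
  have a: "0 \<le> a" "a \<le> N f" using finA nn[of f] nn0 by (auto simp: a_def \<A>_def)
  have aA: "a \<le> slack S" if "S \<in> \<A>" for S using finA that by (auto simp: a_def)
  have a_in: "a \<in> insert (N f) (slack ` \<A>)" unfolding a_def by (rule Min_in) (use finA in auto)
  have b: "N f - a \<le> slack T" if T: "T \<subseteq> V" "v \<in> T" "u \<notin> T" for T
  proof (cases "a = N f")
    case True then show ?thesis using nn0 T by simp
  next
    case False
    then obtain S where S: "S \<in> \<A>" "a = slack S" using a_in by auto
    then have SV: "S \<subseteq> V" by (simp add: \<A>_def)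
    have "N f \<le> slack (S \<union> T)" using slack[of "S \<union> T"] S T by (auto simp: \<A>_def)
    moreover have "0 \<le> slack (S \<inter> T)" using nn0[of "S \<inter> T"] T by blast
    moreover have "slack (S \<union> T) + slack (S \<inter> T) \<le> slack S + slack T" unfolding slack_def
      by (rule slack_submodular) (use fin SV T finite_subset nn in auto)
    ultimately have "N f \<le> slack S + slack T" by linarith
    then show ?thesis using S by (simp add: algebra_simps)
  qed
  have "sum N (inner_edges E ends S) \<le> sum (take_edge (ends f) a (N f - a) D) S" if S: "S \<subseteq> V" for S
  proof -
    have "finite S" using S fin finite_subset by auto
    then have "sum (take_edge (ends f) a (N f - a) D) S - sum N (inner_edges E ends S)
       = slack S - a * of_bool (u \<in> S) - (N f - a) * of_bool (v \<in> S)"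
      by (simp add: sum_take_edge slack_def u_def v_def)
    also have "0 \<le> \<dots>"
      using slack[OF S] nn0[OF S] b[of S] aA[of S] S by (cases "u \<in> S"; cases "v \<in> S") (auto simp: \<A>_def)
    finally show ?thesis by simp
  qed
  then show ?thesis using a that[of a] by (simp add: dominates_def)
qed

lemma dominates_insertI:
  fixes N :: "'e \<Rightarrow> 'a::linordered_idom"
  assumes fin: "finite V" "finite E" "f \<notin> E"
    and a: "0 \<le> a" "a \<le> N f" and dom: "dominates V E ends N (take_edge (ends f) a (N f - a) D)"
  shows "dominates V (insert f E) ends N D"
  unfolding dominates_def
proof (intro allI impI)
  fix S assume S: "S \<subseteq> V"
  then have "finite S" using fin finite_subset by auto
  moreover have "sum N (inner_edges E ends S) \<le> sum (take_edge (ends f) a (N f - a) D) S"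
    using dom S by (simp add: dominates_def)
  ultimately show "sum N (inner_edges (insert f E) ends S) \<le> sum D S"
    using a fin by (auto simp: sum_inner_edges_insert sum_take_edge of_bool_def split: if_splits)
qed

text \<open>Geometrically, adding \<open>f\<close> replaces the solution set by its Minkowski sum
  with the segment from \<open>N f\<close> times \<open>e_v\<close> to \<open>N f\<close> times
  \<open>e_u\<close>; over the integers, with the lattice points of that segment.\<close>

lemma dominates_insert_iff:
  fixes N :: "'e \<Rightarrow> 'a::linordered_idom"
  assumes fin: "finite V" "finite E" "f \<notin> E" and V: "fst (ends f) \<in> V" "snd (ends f) \<in> V"
    and nn: "\<And>g. g \<in> insert f E \<Longrightarrow> 0 \<le> N g"
  shows "dominates V (insert f E) ends N D \<longleftrightarrow>
     (\<exists>a. 0 \<le> a \<and> a \<le> N f \<and> dominates V E ends N (take_edge (ends f) a (N f - a) D))"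
proof
  assume "dominates V (insert f E) ends N D"
  from dominates_insertE[OF fin V _ this] nn show
    "\<exists>a. 0 \<le> a \<and> a \<le> N f \<and> dominates V E ends N (take_edge (ends f) a (N f - a) D)" by metis
qed (use dominates_insertI[OF fin] in blast)

definition load :: "'e set \<Rightarrow> ('e \<Rightarrow> 'v \<times> 'v) \<Rightarrow> ('e \<Rightarrow> 'a) \<Rightarrow> ('e \<Rightarrow> 'a) \<Rightarrow> 'v \<Rightarrow> 'a::linordered_idom" where
  "load E ends N a w =
     (\<Sum>f\<in>E. a f * of_bool (w = fst (ends f)) + (N f - a f) * of_bool (w = snd (ends f)))"

text \<open>A weighted form of Hakimi's orientation theorem, obtained by splitting off one edge at a
  time with \<open>dominates_insertE\<close>. The shares are found without division, so integral
  data yield integral shares.\<close>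

lemma dominates_obtain_load:
  fixes N :: "'e \<Rightarrow> 'a::linordered_idom"
  assumes "finite E" "finite V"
    and "\<And>f. f \<in> E \<Longrightarrow> fst (ends f) \<in> V \<and> snd (ends f) \<in> V"
    and "\<And>f. f \<in> E \<Longrightarrow> 0 \<le> N f"
    and "dominates V E ends N D"
  shows "\<exists>a. (\<forall>f\<in>E. 0 \<le> a f \<and> a f \<le> N f) \<and> (\<forall>w\<in>V. load E ends N a w \<le> D w)"
  using assms
proof (induction E arbitrary: D)
  case empty
  have "0 \<le> D w" if "w \<in> V" for w
    using empty(4) that by (auto simp: dominates_def dest: spec[of _ "{w}"])
  then show ?case by (simp add: load_def)
next
  case (insert f E)
  obtain a where a: "0 \<le> a" "a \<le> N f" "dominates V E ends N (take_edge (ends f) a (N f - a) D)"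
    by (rule dominates_insertE[of V E f ends N D]) (use insert in auto)
  from insert.IH[OF insert.prems(1) _ _ a(3)] insert.prems obtain a' where
    a': "\<forall>f\<in>E. 0 \<le> a' f \<and> a' f \<le> N f" "\<forall>w\<in>V. load E ends N a' w \<le> take_edge (ends f) a (N f - a) D w"
    by auto
  have *: "load (insert f E) ends N (a'(f := a)) w = load E ends N a' w
       + a * of_bool (w = fst (ends f)) + (N f - a) * of_bool (w = snd (ends f))" for w
    unfolding load_def using insert.hyps by (auto intro!: sum.cong)
  have "load (insert f E) ends N (a'(f := a)) w \<le> D w" if "w \<in> V" for w
    using a'(2)[rule_format, OF that] unfolding * take_edge_def by linarith
  moreover have "\<forall>g\<in>insert f E. 0 \<le> (a'(f := a)) g \<and> (a'(f := a)) g \<le> N g"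
    using a a'(1) by auto
  ultimately show ?case by blast
qed

text \<open>Double counting: an edge inside \<open>S\<close> puts its whole demand on vertices of
  \<open>S\<close>, and every other edge puts a nonnegative amount there.\<close>

lemma dominates_loadI:
  fixes N :: "'e \<Rightarrow> 'a::linordered_idom"
  assumes "finite E" "finite V"
    and "\<And>f. f \<in> E \<Longrightarrow> fst (ends f) \<in> V \<and> snd (ends f) \<in> V"
    and a: "\<And>f. f \<in> E \<Longrightarrow> 0 \<le> a f \<and> a f \<le> N f" and D: "\<And>w. w \<in> V \<Longrightarrow> load E ends N a w \<le> D w"
  shows "dominates V E ends N D"
  unfolding dominates_def
proof (intro allI impI)
  fix S assume S: "S \<subseteq> V"
  then have finS: "finite S" using assms(2) finite_subset by auto
  have "sum N (inner_edges E ends S) = (\<Sum>f\<in>inner_edges E ends S. \<Sum>w\<in>S.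
      a f * of_bool (w = fst (ends f)) + (N f - a f) * of_bool (w = snd (ends f)))"
    by (rule sum.cong) (auto simp: sum.distrib sum_of_bool_mult finS inner_edges_def)
  also have "\<dots> \<le> (\<Sum>f\<in>E. \<Sum>w\<in>S.
      a f * of_bool (w = fst (ends f)) + (N f - a f) * of_bool (w = snd (ends f)))"
    by (rule sum_mono2) (use assms in \<open>auto simp: inner_edges_def intro!: sum_nonneg add_nonneg_nonneg\<close>)
  also have "\<dots> = sum (load E ends N a) S" unfolding load_def by (rule sum.swap)
  also have "\<dots> \<le> sum D S" using S D by (intro sum_mono) auto
  finally show "sum N (inner_edges E ends S) \<le> sum D S" .
qed

section \<open>Components and forests under contraction\<close>

text \<open>The vertex type stays fixed: \<open>v\<close> is renamed to \<open>u\<close> and the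
  vertex set shrinks to \<open>V - {v}\<close>. For this reason \<open>comps\<close>,
  \<open>configs\<close> and the notions built on them take \<open>V\<close> as an argument.\<close>

definition contract :: "'v \<Rightarrow> 'v \<Rightarrow> ('e \<Rightarrow> 'v \<times> 'v) \<Rightarrow> 'e \<Rightarrow> 'v \<times> 'v" where
  "contract u v ends = map_prod (id(v := u)) (id(v := u)) \<circ> ends"

definition comps :: "'v set \<Rightarrow> ('e \<Rightarrow> 'v \<times> 'v) \<Rightarrow> 'e set \<Rightarrow> nat" where
  "comps V ends H = card (V // (edge_rel ends H)\<^sup>*)"

lemma num_components_eq_comps: "num_components ends H = comps UNIV ends H"
  by (simp add: num_components_def comps_def)

lemma equiv_edge_rel: "equiv UNIV ((edge_rel ends H)\<^sup>*)"
proof (rule equivI)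
  have "sym (edge_rel ends H)" by (auto simp: sym_def edge_rel_def)
  then show "sym ((edge_rel ends H)\<^sup>*)" by (rule sym_rtrancl)
qed (auto simp: refl_rtrancl trans_rtrancl)

lemma card_image_eq_if_same_kernel:
  assumes "\<And>x y. x \<in> A \<Longrightarrow> y \<in> A \<Longrightarrow> f x = f y \<longleftrightarrow> g x = g y"
  shows "card (f ` A) = card (g ` A)"
proof -
  have *: "g (inv_into A f (f x)) = g x" if "x \<in> A" for x
    using that assms[of "inv_into A f (f x)" x] by (simp add: f_inv_into_f inv_into_into)
  have "bij_betw (\<lambda>z. g (inv_into A f z)) (f ` A) (g ` A)"
    unfolding bij_betw_def inj_on_def by (auto simp: * assms image_image cong: image_cong)
  then show ?thesis by (rule bij_betw_same_card)
qed

lemma quotient_eq_image: "A // r = (\<lambda>x. r `` {x}) ` A"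
  by (auto simp: quotient_def)

text \<open>The edge \<open>f\<close> connects each \<open>x\<close> with \<open>\<rho> x\<close>,
  so renaming never leaves a component. A step along \<open>f\<close> collapses to an equality, and
  an edge of the contraction lifts to a path.\<close>

lemma edge_rel_contract_iff:
  fixes u v :: 'v
  assumes f: "ends f = (u, v)"
  defines "\<rho> \<equiv> id(v := u)"
  shows "(x, y) \<in> (edge_rel ends (insert f H))\<^sup>* \<longleftrightarrow> (\<rho> x, \<rho> y) \<in> (edge_rel (contract u v ends) H)\<^sup>*"
    (is "_ \<in> ?R\<^sup>* \<longleftrightarrow> _ \<in> ?R'\<^sup>*")
proof
  assume "(x, y) \<in> ?R\<^sup>*"
  then show "(\<rho> x, \<rho> y) \<in> ?R'\<^sup>*"
  proof induction
    case (step y z)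
    then have "\<rho> y = \<rho> z \<or> (\<rho> y, \<rho> z) \<in> ?R'"
      using f by (fastforce simp: edge_rel_def \<rho>_def contract_def)
    with step.IH show ?case by auto
  qed simp
next
  have "(v, u) \<in> ?R" "(u, v) \<in> ?R" using f by (auto simp: edge_rel_def)
  then have \<rho>: "(z, \<rho> z) \<in> ?R\<^sup>*" "(\<rho> z, z) \<in> ?R\<^sup>*" for z by (auto simp: \<rho>_def)
  have "?R' \<subseteq> ?R\<^sup>*"
  proof
    fix p assume "p \<in> ?R'"
    then obtain g where "g \<in> H" "contract u v ends g = p \<or> contract u v ends g = (snd p, fst p)"
      by (auto simp: edge_rel_def)
    then obtain a b where "(a, b) \<in> ?R" "p = (\<rho> a, \<rho> b)"
      by (cases "ends g"; cases p) (auto simp: edge_rel_def contract_def \<rho>_def simp del: fun_upd_apply)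
    then show "p \<in> ?R\<^sup>*" using \<rho>(2)[of a] \<rho>(1)[of b] by (meson r_into_rtrancl rtrancl_trans)
  qed
  then have "?R'\<^sup>* \<subseteq> ?R\<^sup>*" by (rule rtrancl_subset_rtrancl)
  moreover assume "(\<rho> x, \<rho> y) \<in> ?R'\<^sup>*"
  ultimately show "(x, y) \<in> ?R\<^sup>*" using \<rho>(1)[of x] \<rho>(2)[of y] by (meson rtrancl_trans subsetD)
qed

text \<open>Sending a vertex of \<open>V\<close> to its component, or to the component of its
  renamed copy in the contraction, identifies the same pairs, so the two images have the same
  size.\<close>

lemma comps_insert_nonloop:
  assumes f: "ends f = (u, v)" and "u \<noteq> v" "u \<in> V" "v \<in> V"
  shows "comps V ends (insert f H) = comps (V - {v}) (contract u v ends) H"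
proof -
  let ?R = "(edge_rel ends (insert f H))\<^sup>*" and ?R' = "(edge_rel (contract u v ends) H)\<^sup>*"
  let ?\<rho> = "id(v := u)"
  have "comps V ends (insert f H) = card ((\<lambda>x. ?R `` {x}) ` V)"
    by (simp add: comps_def quotient_eq_image)
  also have "\<dots> = card ((\<lambda>x. ?R' `` {?\<rho> x}) ` V)"
  proof (rule card_image_eq_if_same_kernel)
    fix x y
    have "(?R `` {x} = ?R `` {y}) \<longleftrightarrow> (x, y) \<in> ?R"
      using eq_equiv_class_iff[OF equiv_edge_rel, of x y] by simp
    also have "\<dots> \<longleftrightarrow> (?\<rho> x, ?\<rho> y) \<in> ?R'" by (rule edge_rel_contract_iff[of ends f u v, OF f])
    also have "\<dots> \<longleftrightarrow> ?R' `` {?\<rho> x} = ?R' `` {?\<rho> y}"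
      by (rule eq_equiv_class_iff[OF equiv_edge_rel UNIV_I UNIV_I, symmetric])
    finally show "(?R `` {x} = ?R `` {y}) \<longleftrightarrow> (?R' `` {?\<rho> x} = ?R' `` {?\<rho> y})" .
  qed
  also have "(\<lambda>x. ?R' `` {?\<rho> x}) ` V = (\<lambda>x. ?R' `` {x}) ` (?\<rho> ` V)"
    by (simp only: image_image)
  also have "?\<rho> ` V = V - {v}" using assms by (auto simp: image_iff)
  finally show ?thesis by (simp add: comps_def quotient_eq_image)
qed

lemma comps_insert_loop:
  assumes "ends f = (u, u)"
  shows "comps V ends (insert f H) = comps V ends H"
proof -
  have "edge_rel ends (insert f H) = edge_rel ends H \<union> {(u, u)}"
    using assms by (auto simp: edge_rel_def)
  then have "edge_rel ends H \<subseteq> edge_rel ends (insert f H)"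
    "edge_rel ends (insert f H) \<subseteq> (edge_rel ends H)\<^sup>*" by auto
  then have "(edge_rel ends (insert f H))\<^sup>* = (edge_rel ends H)\<^sup>*" by (rule rtrancl_subset)
  then show ?thesis by (simp add: comps_def)
qed

lemma comps_empty [simp]: "comps V ends {} = card V"
proof -
  have "(edge_rel ends {})\<^sup>* = Id" by (simp add: edge_rel_def)
  then have "V // (edge_rel ends {})\<^sup>* = (\<lambda>x. {x}) ` V" by (auto simp: quotient_eq_image)
  then show ?thesis by (simp add: comps_def card_image)
qed

text \<open>Induction through contraction: a loop adds an edge and keeps the components, a non-loop
  trades an edge for a vertex. Equality characterises forests, and this is how they are recognised
  below.\<close>

lemma card_le_comps_plus_card:
  assumes "finite H" "finite V" "\<And>f. f \<in> H \<Longrightarrow> fst (ends f) \<in> V \<and> snd (ends f) \<in> V"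
  shows "card V \<le> comps V ends H + card H"
  using assms
proof (induction H arbitrary: V ends)
  case (insert f H)
  obtain u v where f: "ends f = (u, v)" by fastforce
  have uv: "u \<in> V" "v \<in> V" using insert.prems(2)[of f] f by auto
  show ?case
  proof (cases "u = v")
    case True
    then show ?thesis
      using comps_insert_loop[of ends f u V H] insert.IH[of V ends] f insert.prems insert.hyps by auto
  next
    case False
    have "card (V - {v}) \<le> comps (V - {v}) (contract u v ends) H + card H"
      using insert.prems uv False by (intro insert.IH) (auto simp: contract_def)
    then show ?thesis
      using comps_insert_nonloop[of ends f u v V H] f False uv insert.prems insert.hyps by simp
  qed
qed simp

text \<open>Closing up under the larger relation maps the components of \<open>H\<close> onto those
  of \<open>E\<close>.\<close>

lemma comps_antimono:
  assumes "finite V" "H \<subseteq> E"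
  shows "comps V ends E \<le> comps V ends H"
proof -
  let ?R = "(edge_rel ends H)\<^sup>*" and ?R' = "(edge_rel ends E)\<^sup>*"
  have "edge_rel ends H \<subseteq> edge_rel ends E" using assms by (auto simp: edge_rel_def)
  then have sub: "?R \<subseteq> ?R'" by (rule rtrancl_mono)
  have "?R' `` (?R `` {x}) = ?R' `` {x}" for x
  proof (intro equalityI subsetI)
    fix y assume "y \<in> ?R' `` (?R `` {x})"
    then obtain z where "(x, z) \<in> ?R'" "(z, y) \<in> ?R'" using sub by blast
    then have "(x, y) \<in> ?R'" by (rule rtrancl_trans)
    then show "y \<in> ?R' `` {x}" by simp
  qed blast
  then have "V // ?R' = (\<lambda>X. ?R' `` X) ` (V // ?R)"
    by (simp add: quotient_eq_image image_image)
  then show ?thesis unfolding comps_def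
    using assms card_image_le[of "V // ?R" "\<lambda>X. ?R' `` X"] by (simp add: quotient_eq_image)
qed

text \<open>The condition on \<open>H\<close> is the equality case of
  \<open>card_le_comps_plus_card\<close>, so \<open>H\<close> runs over the forests. In this form
  the h-star polynomial is computed before it is matched with the Tutte polynomial.\<close>

definition forest_sum :: "'v set \<Rightarrow> 'e set \<Rightarrow> ('e \<Rightarrow> 'v \<times> 'v) \<Rightarrow> real fps" where
  "forest_sum V E ends = (\<Sum>H | H \<subseteq> E \<and> comps V ends H + card H = card V.
     (2 * fps_X) ^ card H * (1 + fps_X) ^ (card E - card H))"

lemma forest_sum_empty [simp]: "forest_sum V {} ends = 1"
proof -
  have "{H. H \<subseteq> {} \<and> comps V ends H + card H = card V} = {{}}" by auto
  then show ?thesis by (simp add: forest_sum_def)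
qed

text \<open>Subsets are split by whether they contain \<open>f\<close>. The second sum is left
  unevaluated, since a loop makes it empty and a non-loop turns it into the forest sum of the
  contraction.\<close>

lemma forest_sum_insert:
  assumes fin: "finite E" "f \<notin> E"
  shows "forest_sum V (insert f E) ends = (1 + fps_X) * forest_sum V E ends
    + 2 * fps_X * (\<Sum>H | H \<subseteq> E \<and> comps V ends (insert f H) + Suc (card H) = card V.
     (2 * fps_X) ^ card H * (1 + fps_X) ^ (card E - card H))"
proof -
  let ?A = "{H. H \<subseteq> E \<and> comps V ends H + card H = card V}"
  let ?B = "{H. H \<subseteq> E \<and> comps V ends (insert f H) + Suc (card H) = card V}"
  let ?t = "\<lambda>H. (2 * fps_X) ^ card H * (1 + fps_X) ^ (card (insert f E) - card H) :: real fps"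
  have cardH: "card (insert f H) = Suc (card H)" "card H \<le> card E" if "H \<subseteq> E" for H
  proof -
    have "finite H" "f \<notin> H" using that fin finite_subset by auto
    then show "card (insert f H) = Suc (card H)" by simp
    show "card H \<le> card E" using that fin by (simp add: card_mono)
  qed
  have split: "{H. H \<subseteq> insert f E \<and> comps V ends H + card H = card V} = ?A \<union> insert f ` ?B"
  proof (intro set_eqI iffI)
    fix H assume H: "H \<in> {H. H \<subseteq> insert f E \<and> comps V ends H + card H = card V}"
    show "H \<in> ?A \<union> insert f ` ?B"
    proof (cases "f \<in> H")
      case True
      then have "H = insert f (H - {f})" "H - {f} \<subseteq> E" using H by auto
      then have "H - {f} \<in> ?B" using H cardH[of "H - {f}"] by auto
      then show ?thesis using \<open>H = insert f (H - {f})\<close> by blast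
    qed (use H in auto)
  qed (use cardH in auto)
  have "forest_sum V (insert f E) ends = sum ?t ?A + sum ?t (insert f ` ?B)"
    unfolding forest_sum_def split by (rule sum.union_disjoint) (use fin in auto)
  also have "sum ?t ?A = (1 + fps_X) * forest_sum V E ends"
    unfolding forest_sum_def sum_distrib_left
    by (rule sum.cong) (use fin cardH in \<open>auto simp: Suc_diff_le algebra_simps\<close>)
  also have "sum ?t (insert f ` ?B) = sum (?t \<circ> insert f) ?B"
    by (rule sum.reindex) (use fin in \<open>auto simp: inj_on_def\<close>)
  also have "\<dots> = 2 * fps_X * (\<Sum>H\<in>?B. (2 * fps_X) ^ card H * (1 + fps_X) ^ (card E - card H))"
    unfolding sum_distrib_left by (rule sum.cong) (use fin cardH in \<open>auto simp: algebra_simps\<close>)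
  finally show ?thesis .
qed

lemma forest_sum_insert_loop:
  assumes fin: "finite E" "f \<notin> E" and V: "finite V" "\<And>g. g \<in> E \<Longrightarrow> fst (ends g) \<in> V \<and> snd (ends g) \<in> V"
    and f: "ends f = (u, u)"
  shows "forest_sum V (insert f E) ends = (1 + fps_X) * forest_sum V E ends"
proof -
  have "comps V ends (insert f H) + Suc (card H) \<noteq> card V" if "H \<subseteq> E" for H
  proof -
    have "card V \<le> comps V ends H + card H"
      using that assms finite_subset by (intro card_le_comps_plus_card) auto
    then show ?thesis by (simp add: comps_insert_loop[of ends f u, OF f])
  qed
  then have "{H. H \<subseteq> E \<and> comps V ends (insert f H) + Suc (card H) = card V} = {}" by blast
  then show ?thesis unfolding forest_sum_insert[OF fin] by (simp only: sum.empty mult_zero_right add_0_right)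
qed

lemma forest_sum_insert_nonloop:
  assumes fin: "finite E" "f \<notin> E" and V: "finite V" "u \<in> V" "v \<in> V" "u \<noteq> v" and f: "ends f = (u, v)"
  shows "forest_sum V (insert f E) ends =
    (1 + fps_X) * forest_sum V E ends + 2 * fps_X * forest_sum (V - {v}) E (contract u v ends)"
proof -
  have "Suc k = card V \<longleftrightarrow> k = card (V - {v})" for k
    using card_Suc_Diff1[OF V(1,3)] by linarith
  then show ?thesis
    unfolding forest_sum_insert[OF fin] comps_insert_nonloop[of ends f u v, OF f V(4,2,3)] add_Suc_right
    by (simp only: forest_sum_def)
qed

section \<open>Counting integral solutions\<close>

lemma take_edge_take_edge [simp]: "take_edge p a b (take_edge p c d D) = take_edge p (a + c) (b + d) D"
  by (rule ext) (simp add: take_edge_def algebra_simps)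

lemma take_edge_0 [simp]: "take_edge p 0 0 D = D"
  by (simp add: take_edge_def)

lemma dominates_nonneg:
  assumes "dominates V E ends N D" "\<And>f. f \<in> E \<Longrightarrow> 0 \<le> N f" "w \<in> V"
  shows "0 \<le> D w"
proof -
  have "sum N (inner_edges E ends {w}) \<le> sum D {w}" using assms(1,3) unfolding dominates_def by blast
  moreover have "0 \<le> sum N (inner_edges E ends {w})"
    using assms(2) inner_edges_subset[of E ends "{w}"] by (intro sum_nonneg) auto
  ultimately show ?thesis by simp
qed

lemma load_contract:
  fixes N :: "'e \<Rightarrow> 'a::linordered_idom"
  assumes "u \<noteq> v" "w \<noteq> v"
  shows "load E (contract u v ends) N a w = load E ends N a w + of_bool (w = u) * load E ends N a v"
proof -
  have "of_bool (w = (id(v := u)) x) = of_bool (w = x) + (of_bool (w = u) * of_bool (v = x) :: 'a)" for x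
    using assms by auto
  then show ?thesis
    unfolding load_def sum_distrib_left sum.distrib[symmetric]
    by (intro sum.cong refl) (simp add: contract_def algebra_simps del: fun_upd_apply)
qed

text \<open>Values outside \<open>V\<close> are pinned to 0, so that functions on the whole vertex
  type represent each solution on \<open>V\<close> exactly once.\<close>

definition configs ::
  "'v set \<Rightarrow> 'e set \<Rightarrow> ('e \<Rightarrow> 'v \<times> 'v) \<Rightarrow> ('e \<Rightarrow> int) \<Rightarrow> int \<Rightarrow> ('v \<Rightarrow> int) set" where
  "configs V E ends N s = {D. (\<forall>w. w \<notin> V \<longrightarrow> D w = 0) \<and> dominates V E ends N D \<and> sum D V = s}"

lemma finite_configs:
  assumes "finite V" "\<And>f. f \<in> E \<Longrightarrow> 0 \<le> N f"
  shows "finite (configs V E ends N s)"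
proof (rule finite_subset)
  show "configs V E ends N s \<subseteq> {D. \<forall>w. (w \<in> V \<longrightarrow> D w \<in> {0..s}) \<and> (w \<notin> V \<longrightarrow> D w = 0)}"
  proof (clarify, intro conjI impI)
    fix D w assume D: "D \<in> configs V E ends N s"
    then have nn: "0 \<le> D w" if "w \<in> V" for w
      using that assms by (auto simp: configs_def dest: dominates_nonneg)
    have s: "sum D V = s" using D by (simp add: configs_def)
    show "D w \<in> {0..s}" if "w \<in> V"
      using nn that member_le_sum[of w V D] assms s by auto
    show "D w = 0" if "w \<notin> V" using D that by (simp add: configs_def)
  qed
  show "finite {D. \<forall>w. (w \<in> V \<longrightarrow> D w \<in> {0..s}) \<and> (w \<notin> V \<longrightarrow> D w = 0)}"
    using assms by (intro finite_set_of_finite_funs) auto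
qed

lemma configs_cong:
  assumes "\<And>f. f \<in> E \<Longrightarrow> N f = N' f"
  shows "configs V E ends N s = configs V E ends N' s"
proof -
  have "sum N (inner_edges E ends S) = sum N' (inner_edges E ends S)" for S
    using assms inner_edges_subset[of E ends S] by (intro sum.cong) auto
  then show ?thesis by (simp add: configs_def dominates_def)
qed

section \<open>One more edge: loops, and fibres over the contraction\<close>

text \<open>All splittings of the demand of a loop have the same effect, so the thickening is a mere
  translation by \<open>N f\<close> at \<open>u\<close>.\<close>

lemma card_configs_insert_loop:
  assumes fin: "finite V" "finite E" "f \<notin> E" and f: "ends f = (u, u)" "u \<in> V"
    and nn: "\<And>g. g \<in> insert f E \<Longrightarrow> 0 \<le> N g"
  shows "card (configs V (insert f E) ends N s) = card (configs V E ends N (s - N f))"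
proof -
  have iff: "dominates V (insert f E) ends N D \<longleftrightarrow> dominates V E ends N (take_edge (u, u) (N f) 0 D)" for D
  proof -
    have "take_edge (u, u) a (N f - a) D = take_edge (u, u) (N f) 0 D" for a
      by (auto simp: take_edge_def)
    then show ?thesis
      using dominates_insert_iff[of V E f ends N D, OF fin _ _ nn] f nn[of f] by auto
  qed
  have "bij_betw (take_edge (u, u) (N f) 0) (configs V (insert f E) ends N s) (configs V E ends N (s - N f))"
  proof (rule bij_betwI[where g = "take_edge (u, u) (- N f) 0"])
    show "take_edge (u, u) (N f) 0 \<in> configs V (insert f E) ends N s \<rightarrow> configs V E ends N (s - N f)"
      using fin f by (auto simp: configs_def iff sum_take_edge) (auto simp: take_edge_def)
    show "take_edge (u, u) (- N f) 0 \<in> configs V E ends N (s - N f) \<rightarrow> configs V (insert f E) ends N s"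
      using fin f by (auto simp: configs_def iff sum_take_edge) (auto simp: take_edge_def)
  qed auto
  then show ?thesis by (rule bij_betw_same_card)
qed

text \<open>The fibre over \<open>D'\<close> of the map which adds the value at \<open>v\<close> to the value at \<open>u\<close>.\<close>

definition fibre :: "'v set \<Rightarrow> 'e set \<Rightarrow> ('e \<Rightarrow> 'v \<times> 'v) \<Rightarrow> ('e \<Rightarrow> int) \<Rightarrow> 'v \<Rightarrow> 'v \<Rightarrow> ('v \<Rightarrow> int) \<Rightarrow> int set" where
  "fibre V E ends N u v D' = {t. dominates V E ends N (take_edge (u, v) t (- t) D')}"

text \<open>Each inequality is affine in \<open>t\<close>, with a slope that depends on which of
  \<open>u\<close> and \<open>v\<close> lie in \<open>S\<close>, and thus persists between two
  values satisfying it.\<close>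

lemma fibre_convex:
  assumes "finite V" "t1 \<in> fibre V E ends N u v D'" "t2 \<in> fibre V E ends N u v D'" "t1 \<le> t" "t \<le> t2"
  shows "t \<in> fibre V E ends N u v D'"
  unfolding fibre_def dominates_def mem_Collect_eq
proof (intro allI impI)
  fix S assume S: "S \<subseteq> V"
  then have "finite S" using assms(1) finite_subset by blast
  moreover have "sum N (inner_edges E ends S) \<le> sum (take_edge (u, v) t1 (- t1) D') S"
    "sum N (inner_edges E ends S) \<le> sum (take_edge (u, v) t2 (- t2) D') S"
    using assms(2,3) S by (auto simp: fibre_def dominates_def)
  ultimately show "sum N (inner_edges E ends S) \<le> sum (take_edge (u, v) t (- t) D') S"
    using assms(4,5) by (auto simp: sum_take_edge of_bool_def split: if_splits)
qed

context
  fixes V :: "'v set" and E :: "'e set" and ends :: "'e \<Rightarrow> 'v \<times> 'v" and N :: "'e \<Rightarrow> int" and u v :: 'v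
  assumes finV: "finite V" and finE: "finite E"
    and ends_V: "\<And>f. f \<in> E \<Longrightarrow> fst (ends f) \<in> V \<and> snd (ends f) \<in> V"
    and N_nonneg: "\<And>f. f \<in> E \<Longrightarrow> 0 \<le> N f"
    and uv: "u \<in> V" "v \<in> V" "u \<noteq> v"
begin

text \<open>Vertex sets of the contraction correspond to those subsets of \<open>V\<close> that
  contain both or neither of \<open>u\<close> and \<open>v\<close>. On these the transfer of
  \<open>t\<close> cancels.\<close>

lemma dominates_contract:
  assumes D': "D' v = 0" and dom: "dominates V E ends N (take_edge (u, v) t (- t) D')"
  shows "dominates (V - {v}) E (contract u v ends) N D'"
  unfolding dominates_def
proof (intro allI impI)
  fix S assume S: "S \<subseteq> V - {v}"
  define S' where "S' = (if u \<in> S then insert v S else S)"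
  have S': "S' \<subseteq> V" "u \<in> S' \<longleftrightarrow> u \<in> S" "v \<in> S' \<longleftrightarrow> u \<in> S"
    using S uv by (auto simp: S'_def)
  have "finite S" using S finV finite_subset by blast
  moreover have "v \<notin> S" using S by blast
  ultimately have finS': "finite S'" and "sum D' S' = sum D' S" using D' by (auto simp: S'_def)
  then have "sum (take_edge (u, v) t (- t) D') S' = sum D' S" using S' by (simp add: sum_take_edge)
  moreover have "inner_edges E (contract u v ends) S = inner_edges E ends S'"
  proof -
    have "(id(v := u)) x \<in> S \<longleftrightarrow> x \<in> S'" for x using \<open>v \<notin> S\<close> by (simp add: S'_def)
    then show ?thesis by (simp add: inner_edges_def contract_def del: fun_upd_apply)
  qed
  moreover have "sum N (inner_edges E ends S') \<le> sum (take_edge (u, v) t (- t) D') S'"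
    using dom S'(1) unfolding dominates_def by blast
  ultimately show "sum N (inner_edges E (contract u v ends) S) \<le> sum D' S" by simp
qed

text \<open>Shares that fit the contraction also serve the original graph, as the load of the merged
  vertex is the sum of the loads at \<open>u\<close> and \<open>v\<close>. Hence every integral
  solution lifts to an integral one.\<close>

lemma fibre_nonempty:
  assumes "D' v = 0" and dom: "dominates (V - {v}) E (contract u v ends) N D'"
  shows "fibre V E ends N u v D' \<noteq> {}"
proof -
  have "\<exists>a. (\<forall>f\<in>E. 0 \<le> a f \<and> a f \<le> N f) \<and> (\<forall>w\<in>V - {v}. load E (contract u v ends) N a w \<le> D' w)"
  proof (rule dominates_obtain_load[OF finE _ _ N_nonneg dom])
    show "fst (contract u v ends f) \<in> V - {v} \<and> snd (contract u v ends f) \<in> V - {v}" if "f \<in> E" for f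
      using ends_V[OF that] uv by (simp add: contract_def)
  qed (use finV in auto)
  then obtain a where "\<forall>f\<in>E. 0 \<le> a f \<and> a f \<le> N f"
    and "\<forall>w\<in>V - {v}. load E (contract u v ends) N a w \<le> D' w" by (elim exE conjE)
  note a = this(1)[rule_format] and le = this(2)[rule_format]
  \<comment> \<open>The value at \<open>v\<close> becomes exactly its load; what is left at
    \<open>u\<close> still covers the load there.\<close>
  define t where "t = load E ends N a v"
  have "load E ends N a w \<le> take_edge (u, v) t (- t) D' w" if "w \<in> V" for w
  proof (cases "w = v")
    case True
    then show ?thesis using assms(1) uv by (simp add: take_edge_def t_def)
  next
    case False
    then have "load E ends N a w + of_bool (w = u) * t \<le> D' w"
      using le[of w] that load_contract[OF uv(3) False, of E ends N a] unfolding t_def by simp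
    then show ?thesis using False by (simp add: take_edge_def mult.commute)
  qed
  from finE finV ends_V a this have "dominates V E ends N (take_edge (u, v) t (- t) D')"
    by (rule dominates_loadI)
  then show ?thesis by (auto simp: fibre_def)
qed

text \<open>The fibre is bounded because \<open>v\<close> carries \<open>t\<close> and
  \<open>u\<close> carries \<open>D' u - t\<close>, neither negative. That it is never empty is
  essential for the count, as thickening an empty fibre adds nothing.\<close>

lemma fibre_eq_interval:
  assumes "D' v = 0" and dom: "dominates (V - {v}) E (contract u v ends) N D'"
  obtains l h where "l \<le> h" "fibre V E ends N u v D' = {l..h}"
proof -
  let ?T = "fibre V E ends N u v D'"
  have "?T \<subseteq> {0..D' u}"
  proof
    fix t assume "t \<in> ?T"
    then have *: "dominates V E ends N (take_edge (u, v) t (- t) D')" by (simp add: fibre_def)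
    have "0 \<le> take_edge (u, v) t (- t) D' v" "0 \<le> take_edge (u, v) t (- t) D' u"
      using dominates_nonneg[OF *] N_nonneg uv by auto
    then show "t \<in> {0..D' u}" using uv assms by (simp add: take_edge_def)
  qed
  then have fin: "finite ?T" by (rule finite_subset) simp
  have ne: "?T \<noteq> {}" by (rule fibre_nonempty[OF assms])
  have "?T = {Min ?T..Max ?T}"
  proof (intro equalityI subsetI)
    fix t assume "t \<in> {Min ?T..Max ?T}"
    then show "t \<in> ?T" using fibre_convex[OF finV Min_in[OF fin ne] Max_in[OF fin ne]] by simp
  qed (use fin in auto)
  moreover have "Min ?T \<le> Max ?T" using fin ne by simp
  ultimately show ?thesis using that by blast
qed

text \<open>Solutions are sorted by the merged vector \<open>D'\<close>. For \<open>M = 0\<close>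
  this counts the solutions without the new edge, for \<open>M = N f\<close> those with it, so the
  counts differ by \<open>M\<close> per solution of the contraction.\<close>

lemma card_thickened_configs:
  assumes M: "0 \<le> M"
  shows "card {D. (\<forall>w. w \<notin> V \<longrightarrow> D w = 0) \<and> sum D V = s + M \<and>
      (\<exists>b\<in>{0..M}. dominates V E ends N (take_edge (u, v) (M - b) b D))}
    = (\<Sum>D'\<in>configs (V - {v}) E (contract u v ends) N s. card (fibre V E ends N u v D') + nat M)"
    (is "card ?A = sum _ ?C")
proof -
  let ?F = "fibre V E ends N u v"
  \<comment> \<open>The possible values at \<open>v\<close> over \<open>D'\<close>: a point of the
    fibre plus the share \<open>b\<close> charged to \<open>v\<close>.\<close>
  let ?B = "\<lambda>D'. {t. \<exists>b\<in>{0..M}. t - b \<in> ?F D'}"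
  have C0: "D' v = 0" if "D' \<in> ?C" for D' using that by (simp add: configs_def)
  have B: "finite (?B D') \<and> card (?B D') = card (?F D') + nat M" if D': "D' \<in> ?C" for D'
  proof -
    obtain l h where lh: "l \<le> h" "?F D' = {l..h}"
      using fibre_eq_interval[of D'] D' C0[OF D'] by (metis (mono_tags, lifting) configs_def mem_Collect_eq)
    have "?B D' = {l..h + M}"
    proof (intro equalityI subsetI)
      fix t assume "t \<in> {l..h + M}"
      \<comment> \<open>The share \<open>b\<close> is the overshoot of \<open>t\<close> beyond
        \<open>h\<close>, if there is one.\<close>
      then have "max 0 (t - h) \<in> {0..M}" "t - max 0 (t - h) \<in> {l..h}" using lh M by auto
      then show "t \<in> ?B D'" unfolding lh by blast
    qed (use lh in auto)
    then show ?thesis using lh M by auto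
  qed
  \<comment> \<open>The map puts \<open>t\<close> on \<open>v\<close> and
    \<open>D' u + M - t\<close> on \<open>u\<close>, raising the total from \<open>s\<close> to
    \<open>s + M\<close>.\<close>
  have "bij_betw (\<lambda>(D', t). take_edge (u, v) (t - M) (- t) D') (Sigma ?C ?B) ?A"
  proof (rule bij_betwI')
    fix x y assume "x \<in> Sigma ?C ?B" "y \<in> Sigma ?C ?B"
    then obtain D1 t1 D2 t2 where xy: "x = (D1, t1)" "y = (D2, t2)" "D1 v = 0" "D2 v = 0"
      using C0 by blast
    show "((\<lambda>(D', t). take_edge (u, v) (t - M) (- t) D') x = (\<lambda>(D', t). take_edge (u, v) (t - M) (- t) D') y) = (x = y)"
    proof
      assume eq: "(\<lambda>(D', t). take_edge (u, v) (t - M) (- t) D') x = (\<lambda>(D', t). take_edge (u, v) (t - M) (- t) D') y"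
      then have e: "take_edge (u, v) (t1 - M) (- t1) D1 w = take_edge (u, v) (t2 - M) (- t2) D2 w" for w
        using xy fun_cong[OF eq, of w] by simp
      have "t1 = t2" using e[of v] xy uv by (simp add: take_edge_def)
      moreover from this have "D1 w = D2 w" for w using e[of w] by (simp add: take_edge_def)
      ultimately show "x = y" using xy by auto
    qed simp
  next
    fix x assume "x \<in> Sigma ?C ?B"
    then obtain D' t b where x: "x = (D', t)" "D' \<in> ?C" "b \<in> {0..M}" "t - b \<in> ?F D'" by blast
    have "dominates V E ends N (take_edge (u, v) (M - b) b (take_edge (u, v) (t - M) (- t) D'))"
      using x by (simp add: fibre_def algebra_simps)
    moreover have "sum D' V = s" using x C0[OF x(2)] sum.remove[OF finV uv(2), of D'] by (auto simp: configs_def)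
    then have "sum (take_edge (u, v) (t - M) (- t) D') V = s + M"
      using uv finV by (simp add: sum_take_edge)
    moreover have "\<forall>w. w \<notin> V \<longrightarrow> take_edge (u, v) (t - M) (- t) D' w = 0"
      using x uv by (auto simp: configs_def take_edge_def)
    ultimately show "(\<lambda>(D', t). take_edge (u, v) (t - M) (- t) D') x \<in> ?A" using x by auto
  next
    fix D assume "D \<in> ?A"
    then obtain b where D: "\<forall>w. w \<notin> V \<longrightarrow> D w = 0" "sum D V = s + M" "b \<in> {0..M}"
      "dominates V E ends N (take_edge (u, v) (M - b) b D)" by blast
    define t where "t = D v"
    define D' where "D' = take_edge (u, v) (M - t) t D"
    have DD': "D = take_edge (u, v) (t - M) (- t) D'" by (simp add: D'_def)
    have D'v: "D' v = 0" using uv by (simp add: D'_def t_def take_edge_def)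
    have tb: "t - b \<in> ?F D'" using D(4) unfolding fibre_def DD' by (simp add: algebra_simps)
    have "sum D' V = s" using D uv finV by (simp add: D'_def sum_take_edge)
    then have "sum D' (V - {v}) = s" using sum.remove[OF finV uv(2), of D'] D'v by linarith
    moreover have "\<forall>w. w \<notin> V - {v} \<longrightarrow> D' w = 0"
      using D(1) D'v uv by (auto simp: D'_def take_edge_def)
    moreover have "dominates (V - {v}) E (contract u v ends) N D'"
      using dominates_contract[of D' "t - b"] D'v tb by (simp add: fibre_def)
    ultimately have "D' \<in> ?C" by (simp add: configs_def)
    then show "\<exists>x\<in>Sigma ?C ?B. D = (\<lambda>(D', t). take_edge (u, v) (t - M) (- t) D') x"
      using DD' tb D(3) by (intro bexI[of _ "(D', t)"]) auto
  qed
  then have "card ?A = card (Sigma ?C ?B)" by (rule bij_betw_same_card[symmetric])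
  also have "\<dots> = (\<Sum>D'\<in>?C. card (?B D'))"
  proof (rule card_SigmaI)
    show "finite ?C" by (rule finite_configs) (use N_nonneg finV in auto)
  qed (use B in blast)
  also have "\<dots> = (\<Sum>D'\<in>?C. card (?F D') + nat M)" using B by simp
  finally show ?thesis .
qed

lemma card_configs_insert_nonloop:
  assumes "f \<notin> E" "ends f = (u, v)" "0 \<le> N f"
  shows "card (configs V (insert f E) ends N s) = card (configs V E ends N (s - N f))
    + nat (N f) * card (configs (V - {v}) E (contract u v ends) N (s - N f))"
proof -
  have "dominates V (insert f E) ends N D \<longleftrightarrow>
     (\<exists>b\<in>{0..N f}. dominates V E ends N (take_edge (u, v) (N f - b) b D))" for D
  proof -
    have "dominates V (insert f E) ends N D \<longleftrightarrow>
      (\<exists>a. 0 \<le> a \<and> a \<le> N f \<and> dominates V E ends N (take_edge (u, v) a (N f - a) D))"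
      by (subst dominates_insert_iff) (use assms finV finE N_nonneg uv in auto)
    also have "\<dots> \<longleftrightarrow> (\<exists>b\<in>{0..N f}. dominates V E ends N (take_edge (u, v) (N f - b) b D))"
      (is "?l \<longleftrightarrow> ?r")
    proof
      assume ?l
      then obtain a where "0 \<le> a" "a \<le> N f" "dominates V E ends N (take_edge (u, v) a (N f - a) D)" by blast
      then show ?r by (intro bexI[of _ "N f - a"]) auto
    next
      assume ?r
      then obtain b where "b \<in> {0..N f}" "dominates V E ends N (take_edge (u, v) (N f - b) b D)" by blast
      then show ?l by (intro exI[of _ "N f - b"]) auto
    qed
    finally show ?thesis .
  qed
  then have "configs V (insert f E) ends N s = {D. (\<forall>w. w \<notin> V \<longrightarrow> D w = 0) \<and> sum D V = (s - N f) + N f \<and>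
      (\<exists>b\<in>{0..N f}. dominates V E ends N (take_edge (u, v) (N f - b) b D))}"
    by (auto simp: configs_def)
  \<comment> \<open>The count without \<open>f\<close> is written as a thickening by 0, so that
    \<open>card_thickened_configs\<close> applies to both counts.\<close>
  moreover have "configs V E ends N (s - N f) = {D. (\<forall>w. w \<notin> V \<longrightarrow> D w = 0) \<and> sum D V = (s - N f) + 0 \<and>
      (\<exists>b\<in>{0..0}. dominates V E ends N (take_edge (u, v) (0 - b) b D))}"
    by (auto simp: configs_def)
  ultimately show ?thesis
    using assms by (simp only: card_thickened_configs sum.distrib) (simp add: mult.commute)
qed

end

section \<open>Generating functions of the counts\<close>

text \<open>For the edge coordinates \<open>c\<close> of a lattice point in the \<open>j\<close>-th
  dilate, the bound is the inequality for \<open>S = V\<close>: the sum of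
  \<open>2 * max (c f) 0\<close> is at most \<open>j + sum c E\<close>. It keeps the summation over
  \<open>c\<close> finite.\<close>

definition edge_configs :: "'e set \<Rightarrow> nat \<Rightarrow> ('e \<Rightarrow> int) set" where
  "edge_configs E j = {c. (\<forall>f. f \<notin> E \<longrightarrow> c f = 0) \<and> (\<Sum>f\<in>E. \<bar>c f\<bar>) \<le> int j}"

text \<open>The vertex coordinates of such a point sum to \<open>j - sum c E\<close>, and passing to
  \<open>D\<close> adds \<open>c f\<close> at each end of \<open>f\<close>, whence the total
  \<open>j + sum c E\<close>.\<close>

definition config_count :: "'v set \<Rightarrow> 'e set \<Rightarrow> ('e \<Rightarrow> 'v \<times> 'v) \<Rightarrow> nat \<Rightarrow> nat" where
  "config_count V E ends j =
     (\<Sum>c\<in>edge_configs E j. card (configs V E ends (\<lambda>f. 2 * max (c f) 0) (int j + sum c E)))"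

lemma finite_edge_configs:
  assumes "finite E"
  shows "finite (edge_configs E j)"
proof (rule finite_subset)
  show "edge_configs E j \<subseteq> {c. \<forall>f. (f \<in> E \<longrightarrow> c f \<in> {- int j..int j}) \<and> (f \<notin> E \<longrightarrow> c f = 0)}"
  proof (clarify, intro conjI impI)
    fix c f assume c: "c \<in> edge_configs E j"
    show "c f \<in> {- int j..int j}" if "f \<in> E"
      using member_le_sum[of f E "\<lambda>f. \<bar>c f\<bar>"] that c assms by (auto simp: edge_configs_def)
    show "c f = 0" if "f \<notin> E" using c that by (simp add: edge_configs_def)
  qed
  show "finite {c. \<forall>f. (f \<in> E \<longrightarrow> c f \<in> {- int j..int j}) \<and> (f \<notin> E \<longrightarrow> c f = 0)}"
    using assms by (intro finite_set_of_finite_funs) auto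
qed

lemma bij_betw_edge_configs_insert:
  assumes "finite E" "f \<notin> E"
  shows "bij_betw (\<lambda>(t, c). c(f := t)) (SIGMA t:{- int j..int j}. edge_configs E (j - nat \<bar>t\<bar>))
    (edge_configs (insert f E) j)"
proof (rule bij_betwI[where g = "\<lambda>c. (c f, c(f := 0))"])
  have sum: "(\<Sum>g\<in>insert f E. \<bar>(c(f := t)) g\<bar>) = \<bar>t\<bar> + (\<Sum>g\<in>E. \<bar>c g\<bar>)" for c :: "'a \<Rightarrow> int" and t
  proof -
    have "(\<Sum>g\<in>E. \<bar>(c(f := t)) g\<bar>) = (\<Sum>g\<in>E. \<bar>c g\<bar>)" by (rule sum.cong) (use assms in auto)
    then show ?thesis using assms by simp
  qed
  show "(\<lambda>(t, c). c(f := t)) \<in> (SIGMA t:{- int j..int j}. edge_configs E (j - nat \<bar>t\<bar>)) \<rightarrow>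
    edge_configs (insert f E) j"
  proof
    fix p assume "p \<in> (SIGMA t:{- int j..int j}. edge_configs E (j - nat \<bar>t\<bar>))"
    then obtain t c where p: "p = (t, c)" "\<bar>t\<bar> \<le> int j" "c \<in> edge_configs E (j - nat \<bar>t\<bar>)" by auto
    then have "(\<Sum>g\<in>E. \<bar>c g\<bar>) \<le> int j - \<bar>t\<bar>" by (auto simp: edge_configs_def)
    then have "(\<Sum>g\<in>insert f E. \<bar>(c(f := t)) g\<bar>) \<le> int j" using sum[of c t] by linarith
    moreover have "\<forall>g. g \<notin> insert f E \<longrightarrow> (c(f := t)) g = 0" using p by (auto simp: edge_configs_def)
    ultimately show "(\<lambda>(t, c). c(f := t)) p \<in> edge_configs (insert f E) j"
      unfolding p edge_configs_def prod.case by blast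
  qed
  show "(\<lambda>c. (c f, c(f := 0))) \<in> edge_configs (insert f E) j \<rightarrow>
    (SIGMA t:{- int j..int j}. edge_configs E (j - nat \<bar>t\<bar>))"
  proof
    fix c assume c: "c \<in> edge_configs (insert f E) j"
    have le: "\<bar>c f\<bar> + (\<Sum>g\<in>E. \<bar>c g\<bar>) \<le> int j" using c sum[of c "c f"] by (simp add: edge_configs_def)
    moreover have nn: "0 \<le> (\<Sum>g\<in>E. \<bar>c g\<bar>)" by (rule sum_nonneg) simp
    moreover have "(\<Sum>g\<in>E. \<bar>(c(f := 0)) g\<bar>) = (\<Sum>g\<in>E. \<bar>c g\<bar>)" by (rule sum.cong) (use assms in auto)
    ultimately have "\<bar>c f\<bar> \<le> int j" "(\<Sum>g\<in>E. \<bar>(c(f := 0)) g\<bar>) \<le> int (j - nat \<bar>c f\<bar>)" by linarith+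
    moreover have "\<forall>g. g \<notin> E \<longrightarrow> (c(f := 0)) g = 0" using c by (simp add: edge_configs_def)
    ultimately show "(c f, c(f := 0)) \<in> (SIGMA t:{- int j..int j}. edge_configs E (j - nat \<bar>t\<bar>))"
      by (auto simp: edge_configs_def abs_le_iff simp del: fun_upd_apply)
  qed
qed (use assms in \<open>auto simp: edge_configs_def fun_eq_iff\<close>)

lemma sum_int_interval_eq:
  fixes g :: "int \<Rightarrow> 'a::comm_monoid_add"
  shows "(\<Sum>t\<in>{- int j..int j}. g t) = (\<Sum>i=0..j. if i = 0 then g 0 else g (int i) + g (- int i))"
proof (induction j)
  case (Suc j)
  have "{- int (Suc j)..int (Suc j)} = insert (int (Suc j)) (insert (- int (Suc j)) {- int j..int j})"
    by auto
  then show ?case using Suc by (simp add: ac_simps)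
qed simp

text \<open>The factor \<open>m\<close> is \<open>0\<close> for a loop \<open>f\<close> and \<open>1\<close> otherwise, where \<open>V'\<close>, \<open>ends'\<close> describe the contraction.\<close>

lemma config_count_insert:
  assumes fin: "finite E" "f \<notin> E"
    and step: "\<And>N s. (\<And>g. g \<in> insert f E \<Longrightarrow> 0 \<le> N g) \<Longrightarrow>
      card (configs V (insert f E) ends N s) = card (configs V E ends N (s - N f))
       + nat (N f) * card (configs V' E ends' N (s - N f)) * m"
  shows "config_count V (insert f E) ends j =
    (\<Sum>i=0..j. (if i = 0 then 1 else 2) * config_count V E ends (j - i)
       + 2 * i * m * config_count V' E ends' (j - i))"
proof -
  let ?N = "\<lambda>c f. 2 * max (c f) (0::int)"
  let ?w = "\<lambda>c. card (configs V (insert f E) ends (?N c) (int j + sum c (insert f E)))"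
  have w: "?w (c(f := t)) =
      card (configs V E ends (?N c) (int (j - nat \<bar>t\<bar>) + sum c E))
      + nat (2 * t) * m * card (configs V' E ends' (?N c) (int (j - nat \<bar>t\<bar>) + sum c E))"
    if t: "t \<in> {- int j..int j}" for t c
  proof -
    have c1: "configs V E ends (?N (c(f := t))) s = configs V E ends (?N c) s"
      "configs V' E ends' (?N (c(f := t))) s = configs V' E ends' (?N c) s" for s
      using fin by (auto intro!: configs_cong)
    have "sum (c(f := t)) E = sum c E" by (rule sum.cong) (use fin in auto)
    then have s: "sum (c(f := t)) (insert f E) = t + sum c E" using fin by simp
    have "?w (c(f := t)) = card (configs V E ends (?N (c(f := t))) (int j + (t + sum c E) - 2 * max t 0))
       + nat (2 * max t 0) * card (configs V' E ends' (?N (c(f := t))) (int j + (t + sum c E) - 2 * max t 0)) * m"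
      unfolding s by (subst step) simp_all
    \<comment> \<open>As \<open>t - 2 * max t 0\<close> is \<open>- \<bar>t\<bar>\<close>, an edge
      value of either sign lowers the dilation factor by its absolute value.\<close>
    also have "int j + (t + sum c E) - 2 * max t 0 = int (j - nat \<bar>t\<bar>) + sum c E"
      using t by (auto simp: max_def)
    also have "nat (2 * max t 0) = nat (2 * t)" by (simp add: max_def)
    finally show ?thesis unfolding c1 by (simp only: ac_simps)
  qed
  have "config_count V (insert f E) ends j =
    (\<Sum>(t, c)\<in>(SIGMA t:{- int j..int j}. edge_configs E (j - nat \<bar>t\<bar>)). ?w (c(f := t)))"
    unfolding config_count_def
    using sum.reindex_bij_betw[OF bij_betw_edge_configs_insert[OF fin, of j], of ?w]
    by (simp add: case_prod_unfold)
  also have "\<dots> = (\<Sum>t\<in>{- int j..int j}. \<Sum>c\<in>edge_configs E (j - nat \<bar>t\<bar>). ?w (c(f := t)))"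
    by (rule sum.Sigma[symmetric]) (use finite_edge_configs fin in auto)
  also have "\<dots> = (\<Sum>t\<in>{- int j..int j}. config_count V E ends (j - nat \<bar>t\<bar>)
      + nat (2 * t) * m * config_count V' E ends' (j - nat \<bar>t\<bar>))"
    unfolding config_count_def
  proof (intro sum.cong refl)
    fix t assume t: "t \<in> {- int j..int j}"
    show "(\<Sum>c\<in>edge_configs E (j - nat \<bar>t\<bar>). ?w (c(f := t))) =
      (\<Sum>c\<in>edge_configs E (j - nat \<bar>t\<bar>). card (configs V E ends (?N c) (int (j - nat \<bar>t\<bar>) + sum c E)))
      + nat (2 * t) * m *
      (\<Sum>c\<in>edge_configs E (j - nat \<bar>t\<bar>). card (configs V' E ends' (?N c) (int (j - nat \<bar>t\<bar>) + sum c E)))"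
      by (simp only: w[OF t] sum.distrib sum_distrib_left)
  qed
  \<comment> \<open>The values \<open>i\<close> and \<open>- i\<close> are paired: both contribute
    to the graph without \<open>f\<close>, but only the positive one has a demand, namely
    \<open>2 * i\<close>.\<close>
  also have "\<dots> = (\<Sum>i=0..j. (if i = 0 then 1 else 2) * config_count V E ends (j - i)
       + 2 * i * m * config_count V' E ends' (j - i))"
    unfolding sum_int_interval_eq by (intro sum.cong refl) (auto simp: nat_mult_distrib)
  finally show ?thesis .
qed

definition config_fps :: "'v set \<Rightarrow> 'e set \<Rightarrow> ('e \<Rightarrow> 'v \<times> 'v) \<Rightarrow> real fps" where
  "config_fps V E ends = Abs_fps (\<lambda>j. real (config_count V E ends j))"

text \<open>The coefficients count the integers of absolute value \<open>i\<close>; those in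
  \<open>fps_double_index\<close> are the demands of the edge value \<open>i\<close>.\<close>

lemma fps_one_two_two: "Abs_fps (\<lambda>i. if i = 0 then 1 else 2) * (1 - fps_X) = (1 + fps_X :: real fps)"
  by (rule fps_ext) (auto simp: right_diff_distrib fps_X_nth)

lemma fps_double_index: "Abs_fps (\<lambda>i. 2 * real i) * (1 - fps_X)\<^sup>2 = 2 * fps_X"
proof -
  have "Abs_fps (\<lambda>i. 2 * real i) * (1 - fps_X) = Abs_fps (\<lambda>i. if i = 0 then 0 else 2)"
    by (rule fps_ext) (auto simp: right_diff_distrib fps_X_nth of_nat_diff)
  moreover have "Abs_fps (\<lambda>i. if i = 0 then 0 else 2) * (1 - fps_X) = (2 * fps_X :: real fps)"
    by (rule fps_ext) (auto simp: right_diff_distrib fps_X_nth numeral_fps_const)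
  ultimately show ?thesis by (simp add: power2_eq_square mult.assoc[symmetric])
qed

text \<open>The exponents reflect one factor per vertex and edge: leaving out \<open>f\<close> saves
  one, contracting it saves a vertex as well. The result is a recursion between the
  numerators.\<close>

lemma config_fps_insert:
  assumes fin: "finite E" "f \<notin> E"
    and step: "\<And>N s. (\<And>g. g \<in> insert f E \<Longrightarrow> 0 \<le> N g) \<Longrightarrow>
      card (configs V (insert f E) ends N s) = card (configs V E ends N (s - N f))
       + nat (N f) * card (configs V' E ends' N (s - N f)) * m"
  shows "config_fps V (insert f E) ends * (1 - fps_X) ^ Suc (Suc k) =
    (1 + fps_X) * (config_fps V E ends * (1 - fps_X) ^ Suc k)
    + fps_const (real m) * (2 * fps_X) * (config_fps V' E ends' * (1 - fps_X) ^ k)"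
proof -
  let ?a = "Abs_fps (\<lambda>i. if i = 0 then 1 else 2) :: real fps" and ?b = "Abs_fps (\<lambda>i. 2 * real i)"
  have "config_fps V (insert f E) ends = ?a * config_fps V E ends + fps_const (real m) * (?b * config_fps V' E ends')"
  proof (rule fps_ext)
    fix j
    have "config_fps V (insert f E) ends $ j =
      (\<Sum>i=0..j. ?a $ i * config_fps V E ends $ (j - i))
      + real m * (\<Sum>i=0..j. ?b $ i * config_fps V' E ends' $ (j - i))"
    proof -
      have "config_count V (insert f E) ends j = (\<Sum>i=0..j. (if i = 0 then 1 else 2) * config_count V E ends (j - i)
          + 2 * i * m * config_count V' E ends' (j - i))"
        by (rule config_count_insert[OF fin]) (use step in blast)
      then show ?thesis
        by (simp add: config_fps_def sum.distrib sum_distrib_left)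
          (auto intro!: arg_cong2[of _ _ _ _ "(+)"] sum.cong)
    qed
    then show "config_fps V (insert f E) ends $ j =
      (?a * config_fps V E ends + fps_const (real m) * (?b * config_fps V' E ends')) $ j"
      unfolding fps_add_nth fps_mult_left_const_nth fps_mult_nth[of ?a] fps_mult_nth[of ?b] .
  qed
  then have "config_fps V (insert f E) ends * (1 - fps_X) ^ Suc (Suc k) =
    (?a * (1 - fps_X)) * (config_fps V E ends * (1 - fps_X) ^ Suc k)
    + fps_const (real m) * (?b * (1 - fps_X)\<^sup>2) * (config_fps V' E ends' * (1 - fps_X) ^ k)"
    by (simp add: algebra_simps power2_eq_square)
  then show ?thesis unfolding fps_one_two_two fps_double_index .
qed

text \<open>Without edges the solutions are the nonnegative integral vectors of sum
  \<open>j\<close>, that is, the lattice points of a dilated standard simplex.\<close>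

lemma config_fps_no_edges:
  fixes ends :: "'e \<Rightarrow> 'v \<times> 'v"
  assumes "finite V"
  shows "config_fps V {} ends * (1 - fps_X) ^ card V = 1"
  using assms
proof induction
  case empty
  have "configs {} ({} :: 'e set) ends N (int j) = (if j = 0 then {\<lambda>_. 0} else {})" for N j
    by (auto simp: configs_def dominates_def)
  moreover have "edge_configs ({} :: 'e set) j = {\<lambda>_. 0}" for j by (auto simp: edge_configs_def)
  ultimately have "config_count {} {} ends j = (if j = 0 then 1 else 0)" for j
    by (simp add: config_count_def)
  then show ?case by (auto simp: config_fps_def intro!: fps_ext)
next
  case (insert v V)
  have count: "config_count U {} ends j = card (configs U {} ends (\<lambda>_. 0) (int j))" for U :: "'v set" and j
  proof -
    have "edge_configs ({} :: 'e set) j = {\<lambda>_. 0}" by (auto simp: edge_configs_def)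
    then show ?thesis by (simp add: config_count_def)
  qed
  have dom: "dominates U {} ends N D \<longleftrightarrow> (\<forall>w\<in>U. 0 \<le> D w)" for U N and D :: "'v \<Rightarrow> int"
  proof
    assume D: "dominates U {} ends N D"
    show "\<forall>w\<in>U. 0 \<le> D w"
    proof
      fix w assume "w \<in> U" then show "0 \<le> D w" using D by (intro dominates_nonneg[OF D]) auto
    qed
  qed (auto simp: dominates_def intro!: sum_nonneg)
  have sum0: "(\<Sum>w\<in>V. if w = v then t else D w) = sum D V" for D :: "'v \<Rightarrow> int" and t
    by (rule sum.cong) (use insert.hyps in auto)
  \<comment> \<open>The value \<open>i\<close> at the new vertex is split off, and the other values
    sum to \<open>j - i\<close>.\<close>
  have "config_count (insert v V) {} ends j = (\<Sum>i=0..j. config_count V {} ends (j - i))" for j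
  proof -
    let ?C = "\<lambda>j. configs V {} ends (\<lambda>_. 0) (int j)"
    have "bij_betw (\<lambda>(i, D). D(v := int i)) (SIGMA i:{0..j}. ?C (j - i)) (configs (insert v V) {} ends (\<lambda>_. 0) (int j))"
    proof (rule bij_betwI[where g = "\<lambda>D. (nat (D v), D(v := 0))"])
      show "(\<lambda>(i, D). D(v := int i)) \<in> (SIGMA i:{0..j}. ?C (j - i)) \<rightarrow> configs (insert v V) {} ends (\<lambda>_. 0) (int j)"
        using insert.hyps by (auto simp: configs_def dom sum0 simp flip: of_nat_add)
      show "(\<lambda>D. (nat (D v), D(v := 0))) \<in> configs (insert v V) {} ends (\<lambda>_. 0) (int j) \<rightarrow> (SIGMA i:{0..j}. ?C (j - i))"
      proof
        fix D assume "D \<in> configs (insert v V) {} ends (\<lambda>_. 0) (int j)"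
        then have D: "\<forall>w. w \<notin> insert v V \<longrightarrow> D w = 0" "\<forall>w\<in>insert v V. 0 \<le> D w" "D v + sum D V = int j"
          using insert.hyps by (auto simp: configs_def dom)
        then have "0 \<le> sum D V" by (intro sum_nonneg) auto
        then show "(nat (D v), D(v := 0)) \<in> (SIGMA i:{0..j}. ?C (j - i))"
          using D insert.hyps by (auto simp: configs_def dom sum0)
      qed
    qed (use insert.hyps in \<open>auto simp: configs_def dom fun_eq_iff\<close>)
    then have "config_count (insert v V) {} ends j = card (SIGMA i:{0..j}. ?C (j - i))"
      unfolding count by (simp add: bij_betw_same_card)
    also have "\<dots> = (\<Sum>i=0..j. card (?C (j - i)))"
      by (rule card_SigmaI) (use insert.hyps in \<open>auto intro!: finite_configs\<close>)
    finally show ?thesis by (simp add: count)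
  qed
  then have "config_fps (insert v V) {} ends = Abs_fps (\<lambda>_. 1) * config_fps V {} ends"
    by (intro fps_ext) (simp add: config_fps_def fps_mult_nth)
  then have "config_fps (insert v V) {} ends * (1 - fps_X) ^ card (insert v V) =
    (Abs_fps (\<lambda>_. 1) * (1 - fps_X)) * (config_fps V {} ends * (1 - fps_X) ^ card V)"
    using insert.hyps by (simp add: ac_simps)
  also have "Abs_fps (\<lambda>_. 1) * (1 - fps_X) = (1 :: real fps)"
    by (rule fps_ext) (auto simp: right_diff_distrib fps_X_nth)
  finally show ?case using insert.IH by simp
qed

text \<open>Both sides obey the same recursion and agree on graphs without edges. The induction
  keeps \<open>V\<close> and \<open>ends\<close> general because contraction changes both.\<close>

lemma config_fps_eq_forest_sum:
  assumes "finite E" "finite V" "\<And>f. f \<in> E \<Longrightarrow> fst (ends f) \<in> V \<and> snd (ends f) \<in> V"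
  shows "config_fps V E ends * (1 - fps_X) ^ (card V + card E) = forest_sum V E ends"
  using assms
proof (induction E arbitrary: V ends)
  case empty
  then show ?case by (simp add: config_fps_no_edges)
next
  case (insert f E)
  obtain u v where f: "ends f = (u, v)" by fastforce
  have uv: "u \<in> V" "v \<in> V" using insert.prems(2)[of f] f by auto
  have IH: "config_fps V E ends * (1 - fps_X) ^ (card V + card E) = forest_sum V E ends"
    using insert by auto
  \<comment> \<open>\<open>V\<close> contains the ends of \<open>f\<close>, so it is nonempty;
    \<open>n\<close> is the number of vertices left after contracting a non-loop.\<close>
  obtain n where n: "card V = Suc n" using uv insert.prems(1) by (cases "card V") auto
  have exps: "card V + card (insert f E) = Suc (Suc (n + card E))" "card V + card E = Suc (n + card E)"
    using insert.hyps n by auto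
  show ?case
  proof (cases "u = v")
    case True
    have "card (configs V (insert f E) ends N s) = card (configs V E ends N (s - N f))
       + nat (N f) * card (configs V E ends N (s - N f)) * 0" if "\<And>g. g \<in> insert f E \<Longrightarrow> 0 \<le> N g" for N s
      using card_configs_insert_loop[of V E f ends u N s] insert that f True uv by simp
    from config_fps_insert[OF insert.hyps this, of "n + card E"]
    have "config_fps V (insert f E) ends * (1 - fps_X) ^ (card V + card (insert f E)) = (1 + fps_X) * forest_sum V E ends"
      by (simp only: exps IH[unfolded exps] of_nat_0 fps_const_0_eq_0 mult_zero_left add_0_right)
    then show ?thesis using forest_sum_insert_loop[of E f V ends u] insert f True by simp
  next
    case False
    have "card (configs V (insert f E) ends N s) = card (configs V E ends N (s - N f))
       + nat (N f) * card (configs (V - {v}) E (contract u v ends) N (s - N f)) * 1"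
      if "\<And>g. g \<in> insert f E \<Longrightarrow> 0 \<le> N g" for N s
      using card_configs_insert_nonloop[of V E ends N u v f s] insert that f False uv by simp
    from config_fps_insert[OF insert.hyps this, of "n + card E"]
    have "config_fps V (insert f E) ends * (1 - fps_X) ^ (card V + card (insert f E)) =
      (1 + fps_X) * forest_sum V E ends + 2 * fps_X * (config_fps (V - {v}) E (contract u v ends) * (1 - fps_X) ^ (n + card E))"
      by (simp only: exps IH[unfolded exps] of_nat_1 fps_const_1_eq_1 mult_1_left)
    also have "config_fps (V - {v}) E (contract u v ends) * (1 - fps_X) ^ (n + card E)
      = forest_sum (V - {v}) E (contract u v ends)"
    proof -
      have "fst (contract u v ends g) \<in> V - {v} \<and> snd (contract u v ends g) \<in> V - {v}" if "g \<in> E" for g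
        using insert.prems(2)[of g] that uv False by (simp add: contract_def)
      moreover have "card (V - {v}) = n" using n uv by simp
      ultimately show ?thesis using insert.IH[of "V - {v}" "contract u v ends"] insert.prems(1) by simp
    qed
    finally show ?thesis
      using forest_sum_insert_nonloop[of E f V u v ends] insert.hyps insert.prems(1) uv False f by simp
  qed
qed

section \<open>The polytope\<close>

lemma unitv_nth [simp]: "unitv i $ j = of_bool (j = i)"
  by (simp add: unitv_def)

lemma sum_load:
  fixes N :: "'e \<Rightarrow> 'a::linordered_idom"
  assumes "finite V" "\<And>f. f \<in> E \<Longrightarrow> fst (ends f) \<in> V \<and> snd (ends f) \<in> V"
  shows "sum (load E ends N a) V = sum N E"
proof -
  have "sum (load E ends N a) V =
     (\<Sum>f\<in>E. \<Sum>w\<in>V. a f * of_bool (w = fst (ends f)) + (N f - a f) * of_bool (w = snd (ends f)))"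
    unfolding load_def by (rule sum.swap)
  also have "\<dots> = sum N E"
    by (rule sum.cong) (use assms in \<open>auto simp: sum.distrib sum_of_bool_mult\<close>)
  finally show ?thesis .
qed

text \<open>\<open>lift_load E ends c\<close> is \<open>\<Sum>f. c f (e_u + e_v)\<close>, the sum running over the edges \<open>f = uv\<close> in \<open>E\<close>.\<close>

abbreviation lift_load :: "'e set \<Rightarrow> ('e \<Rightarrow> 'v \<times> 'v) \<Rightarrow> ('e \<Rightarrow> 'a) \<Rightarrow> 'v \<Rightarrow> 'a::linordered_idom" where
  "lift_load E ends c \<equiv> load E ends (\<lambda>f. 2 * c f) c"

lemma lift_load_linear:
  "lift_load E ends (\<lambda>f. a * c f + b * d f) w = a * lift_load E ends c w + b * lift_load E ends d w"
  unfolding load_def sum_distrib_left sum.distrib[symmetric]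
  by (rule sum.cong) (auto simp: algebra_simps)

section \<open>Inequality description of the dilates\<close>

text \<open>The claimed description of \<open>s\<close> times the polytope. All conditions except
  the coordinate sum are invariant under positive scaling, so this is the slice of a cone at height
  \<open>s\<close>.\<close>

definition region :: "'e set \<Rightarrow> ('e \<Rightarrow> 'v \<times> 'v) \<Rightarrow> real \<Rightarrow> (real ^ ('v::finite + 'e::finite)) set" where
  "region E ends s = {x. (\<forall>f. f \<notin> E \<longrightarrow> x $ Inr f = 0) \<and> (\<Sum>i\<in>UNIV. x $ i) = s \<and>
     dominates UNIV E ends (\<lambda>f. 2 * max (x $ Inr f) 0)
       (\<lambda>u. x $ Inl u + lift_load E ends (\<lambda>f. x $ Inr f) u)}"

text \<open>\<open>D\<close> is linear in the point and the demand is sublinear. Weights of sum 1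
  give convexity, and \<open>b = 0\<close> gives scaling.\<close>

lemma region_combine:
  assumes x: "x \<in> region E ends s" and y: "y \<in> region E ends t" and ab: "0 \<le> a" "0 \<le> b"
  shows "a *\<^sub>R x + b *\<^sub>R y \<in> region E ends (a * s + b * t)"
proof -
  let ?D = "\<lambda>x u. x $ Inl u + lift_load E ends (\<lambda>f. x $ Inr f) u"
  let ?N = "\<lambda>x f. 2 * max (x $ Inr f) 0"
  let ?z = "a *\<^sub>R x + b *\<^sub>R y"
  have D: "?D ?z u = a * ?D x u + b * ?D y u" for u
    unfolding vector_add_component vector_scaleR_component real_scaleR_def lift_load_linear
    by (simp add: algebra_simps)
  have N: "?N ?z f \<le> a * ?N x f + b * ?N y f" for f
  proof -
    have "a * (x $ Inr f) \<le> a * max (x $ Inr f) 0" "b * (y $ Inr f) \<le> b * max (y $ Inr f) 0"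
      "0 \<le> a * max (x $ Inr f) 0" "0 \<le> b * max (y $ Inr f) 0"
      using ab by (auto intro: mult_left_mono)
    then have "max (a * (x $ Inr f) + b * (y $ Inr f)) 0 \<le> a * max (x $ Inr f) 0 + b * max (y $ Inr f) 0"
      unfolding max.bounded_iff by linarith
    then show ?thesis
      by (simp only: vector_add_component vector_scaleR_component real_scaleR_def
          mult.left_commute[of _ 2] flip: distrib_left) (rule mult_left_mono, simp_all)
  qed
  have "sum (?N ?z) (inner_edges E ends S) \<le> sum (?D ?z) S" for S
  proof -
    have "sum (?N ?z) (inner_edges E ends S) \<le> a * sum (?N x) (inner_edges E ends S) + b * sum (?N y) (inner_edges E ends S)"
      unfolding sum_distrib_left sum.distrib[symmetric] by (rule sum_mono) (rule N)
    also have "\<dots> \<le> a * sum (?D x) S + b * sum (?D y) S"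
      using x y ab by (intro add_mono mult_left_mono) (auto simp: region_def dominates_def)
    also have "\<dots> = sum (?D ?z) S"
      unfolding D sum_distrib_left sum.distrib[symmetric] ..
    finally show ?thesis .
  qed
  moreover have "(\<Sum>i\<in>UNIV. ?z $ i) = a * s + b * t"
    using x y by (simp add: region_def sum.distrib sum_distrib_left[symmetric])
  ultimately show ?thesis using x y by (simp add: region_def dominates_def)
qed

lemma convex_region:
  fixes ends :: "'e::finite \<Rightarrow> 'v::finite \<times> 'v"
  shows "convex (region E ends 1)"
proof (rule convexI)
  fix x y :: "real ^ ('v + 'e)" and a b :: real
  assume "x \<in> region E ends 1" "y \<in> region E ends 1" "0 \<le> a" "0 \<le> b" "a + b = 1"
  then show "a *\<^sub>R x + b *\<^sub>R y \<in> region E ends 1" using region_combine[of x E ends 1 y 1 a b] by simp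
qed

lemma unitv_Inl_in_region: "unitv (Inl u) \<in> region E ends 1"
proof -
  have "lift_load E ends (\<lambda>_. 0) w = (0::real)" for w by (simp add: load_def)
  then show ?thesis by (auto simp: region_def dominates_def intro!: sum_nonneg)
qed

lemma sum_unitv: "(\<Sum>i\<in>UNIV. unitv j $ i) = (1::real)"
  by (simp add: unitv_def)

text \<open>The cases \<open>a = 0\<close>, \<open>a = 1\<close>, \<open>a = 2\<close> are the three
  generators with coefficient 1 at \<open>f\<close>, where \<open>a\<close> is the share of the
  demand 2 charged to \<open>u\<close>. Here \<open>D\<close> equals the load.\<close>

lemma edge_point_in_region:
  fixes ends :: "'e::finite \<Rightarrow> 'v::finite \<times> 'v"
  assumes f: "f \<in> E" "ends f = (u, v)" and a: "0 \<le> a" "a \<le> 2"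
  shows "(a - 1) *\<^sub>R unitv (Inl u) + (1 - a) *\<^sub>R unitv (Inl v) + unitv (Inr f) \<in> region E ends 1"
    (is "?x \<in> _")
proof -
  have x: "?x $ Inr g = of_bool (g = f)" "?x $ Inl w = (a - 1) * of_bool (w = u) + (1 - a) * of_bool (w = v)" for g w
    by auto
  have sum_f: "(\<Sum>g\<in>E. c g * of_bool (g = f)) = c f" for c :: "'e \<Rightarrow> real"
    using f by (subst sum_of_bool_mult) auto
  have load: "load E ends (\<lambda>g. 2 * of_bool (g = f)) (\<lambda>g. t * of_bool (g = f)) w
      = t * of_bool (w = u) + (2 - t) * of_bool (w = v)" for t :: real and w
  proof -
    have "load E ends (\<lambda>g. 2 * of_bool (g = f)) (\<lambda>g. t * of_bool (g = f)) w
      = (\<Sum>g\<in>E. (t * of_bool (w = fst (ends g)) + (2 - t) * of_bool (w = snd (ends g))) * of_bool (g = f))"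
      unfolding load_def by (rule sum.cong) (auto simp: algebra_simps)
    then show ?thesis by (simp add: sum_f f)
  qed
  have "dominates UNIV E ends (\<lambda>g. 2 * of_bool (g = f))
      (\<lambda>w. ?x $ Inl w + load E ends (\<lambda>g. 2 * of_bool (g = f)) (\<lambda>g. 1 * of_bool (g = f)) w)"
    by (rule dominates_loadI[where a = "\<lambda>g. a * of_bool (g = f)"])
      (use a in \<open>auto simp only: finite x load\<close>, auto simp: of_bool_def)
  moreover have "2 * max (?x $ Inr g) 0 = 2 * of_bool (g = f)" for g unfolding x by simp
  moreover have "(\<Sum>i\<in>UNIV. ?x $ i) = 1"
    by (simp add: sum.distrib sum_distrib_left[symmetric] sum_unitv del: unitv_nth)
  moreover have "\<forall>g. g \<notin> E \<longrightarrow> ?x $ Inr g = 0" using f unfolding x by auto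
  ultimately show ?thesis unfolding region_def mem_Collect_eq by (simp only: x mult_1_left)
qed

text \<open>This point has no demand, and the shift cancels its vertex part, so that
  \<open>D = 0\<close>.\<close>

lemma reverse_edge_point_in_region:
  fixes ends :: "'e::finite \<Rightarrow> 'v::finite \<times> 'v"
  assumes f: "f \<in> E" "ends f = (u, v)"
  shows "unitv (Inl u) + unitv (Inl v) - unitv (Inr f) \<in> region E ends 1"
    (is "?x \<in> _")
proof -
  have x: "?x $ Inr g = - 1 * of_bool (g = f)" "?x $ Inl w = of_bool (w = u) + of_bool (w = v)" for g w
    by auto
  have "lift_load E ends (\<lambda>g. - 1 * of_bool (g = f)) w = - of_bool (w = u) - (of_bool (w = v) :: real)" for w
  proof -
    have "lift_load E ends (\<lambda>g. - 1 * of_bool (g = f)) w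
      = (\<Sum>g\<in>E. (- of_bool (w = fst (ends g)) - of_bool (w = snd (ends g))) * (of_bool (g = f) :: real))"
      unfolding load_def by (rule sum.cong) (auto simp: algebra_simps)
    also have "\<dots> = - of_bool (w = u) - (of_bool (w = v) :: real)"
      using f by (subst sum_of_bool_mult) auto
    finally show ?thesis .
  qed
  then have "?x $ Inl w + lift_load E ends (\<lambda>g. ?x $ Inr g) w = 0" for w unfolding x by simp
  moreover have "2 * max (?x $ Inr g) 0 = 0" for g unfolding x by simp
  moreover have "(\<Sum>i\<in>UNIV. ?x $ i) = 1"
    by (simp add: sum.distrib sum_subtractf sum_unitv del: unitv_nth)
  moreover have "\<forall>g. g \<notin> E \<longrightarrow> ?x $ Inr g = 0" using f unfolding x by auto
  ultimately show ?thesis unfolding region_def mem_Collect_eq dominates_def by simp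
qed

lemma cosmological_polytope_subset_region: "cosmological_polytope E ends \<subseteq> region E ends 1"
  unfolding cosmological_polytope_def
proof (rule hull_minimal)
  show "cosmo_points E ends \<subseteq> region E ends 1"
  proof
    fix x assume "x \<in> cosmo_points E ends"
    then consider u where "x = unitv (Inl u)"
      | f where "f \<in> E" "x \<in> {unitv (Inr f),
          unitv (Inl (fst (ends f))) + unitv (Inl (snd (ends f))) - unitv (Inr f),
          unitv (Inl (fst (ends f))) - unitv (Inl (snd (ends f))) + unitv (Inr f),
          - unitv (Inl (fst (ends f))) + unitv (Inl (snd (ends f))) + unitv (Inr f)}"
      by (auto simp: cosmo_points_def Let_def)
    then show "x \<in> region E ends 1"
    proof cases
      case 1
      then show ?thesis by (simp add: unitv_Inl_in_region)
    next
      case 2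
      note e = edge_point_in_region[OF 2(1) prod.collapse[symmetric]]
      from 2(2) e[of 0] e[of 1] e[of 2] reverse_edge_point_in_region[OF 2(1) prod.collapse[symmetric]]
      show ?thesis by auto
    qed
  qed
qed (rule convex_region)

abbreviation dilate :: "real \<Rightarrow> (real ^ 'i) set \<Rightarrow> (real ^ 'i) set" where
  "dilate t P \<equiv> (\<lambda>x. t *\<^sub>R x) ` P"

lemma dilate_add:
  assumes "convex P" "x \<in> dilate s P" "y \<in> dilate t P" "0 \<le> s" "0 \<le> t"
  shows "x + y \<in> dilate (s + t) P"
proof -
  obtain p q where pq: "p \<in> P" "q \<in> P" "x = s *\<^sub>R p" "y = t *\<^sub>R q" using assms by auto
  show ?thesis
  proof (cases "s + t = 0")
    case True
    then have "s = 0" "t = 0" using assms by auto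
    then show ?thesis using pq by auto
  next
    case False
    then have "(s / (s + t)) *\<^sub>R p + (t / (s + t)) *\<^sub>R q \<in> P"
      using assms pq by (intro convexD) (auto simp: add_divide_distrib[symmetric])
    moreover have "x + y = (s + t) *\<^sub>R ((s / (s + t)) *\<^sub>R p + (t / (s + t)) *\<^sub>R q)"
      using False pq by (simp add: scaleR_add_right)
    ultimately show ?thesis by blast
  qed
qed

lemma dilate_sum:
  assumes "convex P" "P \<noteq> {}" "finite I" "\<And>i. i \<in> I \<Longrightarrow> g i \<in> dilate (t i) P \<and> 0 \<le> t i"
  shows "sum g I \<in> dilate (sum t I) P"
  using assms(3,4)
proof (induction I)
  case empty
  then show ?case using assms(2) by auto
next
  case (insert i I)
  then show ?case using assms(1) by (auto intro!: dilate_add sum_nonneg)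
qed

text \<open>Once \<open>dominates_obtain_load\<close> has split the demands between the ends of the
  edges, the shares give the coefficients of \<open>x\<close> as a nonnegative combination of
  generators.\<close>

lemma region_subset_dilate:
  fixes ends :: "'e::finite \<Rightarrow> 'v::finite \<times> 'v"
  assumes x: "x \<in> region E ends s"
  shows "x \<in> dilate s (cosmological_polytope E ends)"
proof -
  let ?P = "cosmological_polytope E ends"
  let ?u = "\<lambda>f. unitv (Inl (fst (ends f))) :: real ^ ('v + 'e)"
  let ?v = "\<lambda>f. unitv (Inl (snd (ends f))) :: real ^ ('v + 'e)"
  let ?e = "\<lambda>f. unitv (Inr f) :: real ^ ('v + 'e)"
  define c where "c = (\<lambda>f. x $ Inr f)"
  define D where "D = (\<lambda>w. x $ Inl w + lift_load E ends c w)"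
  have "\<exists>a. (\<forall>f\<in>E. 0 \<le> a f \<and> a f \<le> 2 * max (c f) 0) \<and> (\<forall>w\<in>UNIV. load E ends (\<lambda>f. 2 * max (c f) 0) a w \<le> D w)"
    by (rule dominates_obtain_load) (use x in \<open>auto simp: region_def c_def D_def\<close>)
  then obtain a where a: "\<And>f. f \<in> E \<Longrightarrow> 0 \<le> a f \<and> a f \<le> 2 * max (c f) 0"
    and le: "\<And>w. load E ends (\<lambda>f. 2 * max (c f) 0) a w \<le> D w" by auto
  \<comment> \<open>The surplus at \<open>w\<close> is the coefficient of \<open>e_w\<close>. In the
    coordinate \<open>D\<close> the generators \<open>e_u - e_v + e_f\<close>,
    \<open>- e_u + e_v + e_f\<close> and \<open>e_u + e_v - e_f\<close> become \<open>2 e_u\<close>,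
    \<open>2 e_v\<close> and 0: the first two take half of each share, the last takes the negative
    part of \<open>c f\<close>.\<close>
  define r where "r w = D w - load E ends (\<lambda>f. 2 * max (c f) 0) a w" for w
  define p where "p f = a f / 2" for f
  define q where "q f = max (c f) 0 - a f / 2" for f
  define n where "n f = max (- c f) 0" for f
  have convex: "convex ?P" by (simp add: cosmological_polytope_def)
  have inP: "unitv (Inl w) \<in> ?P" for w
    unfolding cosmological_polytope_def by (rule hull_inc) (auto simp: cosmo_points_def)
  have inP_edge: "?u f - ?v f + ?e f \<in> ?P" "- ?u f + ?v f + ?e f \<in> ?P" "?u f + ?v f - ?e f \<in> ?P" if "f \<in> E" for f
    unfolding cosmological_polytope_def by (rule hull_inc; use that in \<open>auto simp: cosmo_points_def Let_def\<close>)+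
  let ?piece = "\<lambda>f. p f *\<^sub>R (?u f - ?v f + ?e f) + q f *\<^sub>R (- ?u f + ?v f + ?e f) + n f *\<^sub>R (?u f + ?v f - ?e f)"
  define x' where "x' = (\<Sum>w\<in>UNIV. r w *\<^sub>R unitv (Inl w)) + (\<Sum>f\<in>E. ?piece f)"
  have "x $ i = x' $ i" for i
  proof (cases i)
    case (Inl w)
    have "?piece f $ Inl w = (a f * of_bool (w = fst (ends f)) + (2 * max (c f) 0 - a f) * of_bool (w = snd (ends f)))
        - (c f * of_bool (w = fst (ends f)) + (2 * c f - c f) * of_bool (w = snd (ends f)))" for f
      by (auto simp: p_def q_def n_def max_def of_bool_def)
    then have "(\<Sum>f\<in>E. ?piece f $ Inl w) = load E ends (\<lambda>f. 2 * max (c f) 0) a w - lift_load E ends c w"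
      unfolding load_def sum_subtractf[symmetric] by (intro sum.cong refl)
    moreover have "(\<Sum>w'\<in>UNIV. r w' *\<^sub>R unitv (Inl w')) $ Inl w = r w"
      using sum_of_bool_mult[of UNIV r w] by (simp add: eq_commute)
    ultimately show ?thesis by (simp add: Inl x'_def r_def D_def)
  next
    case (Inr g)
    have "?piece f $ Inr g = c f * of_bool (f = g)" for f
      by (auto simp: p_def q_def n_def max_def)
    then have "(\<Sum>f\<in>E. ?piece f $ Inr g) = c g * of_bool (g \<in> E)"
      by (simp only: sum_of_bool_mult[OF finite])
    also have "\<dots> = c g" using x by (auto simp: region_def c_def)
    finally show ?thesis by (simp add: Inr x'_def c_def)
  qed
  then have xx': "x = x'" by (simp add: vec_eq_iff)
  define T where "T = (\<Sum>w\<in>UNIV. r w) + (\<Sum>f\<in>E. p f + q f + n f)"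
  have nn: "0 \<le> r w" for w using le by (simp add: r_def)
  have nn_edge: "0 \<le> p f" "0 \<le> q f" "0 \<le> n f" if "f \<in> E" for f
    using a[OF that] by (auto simp: p_def q_def n_def)
  have "?piece f \<in> dilate (p f + q f + n f) ?P" if "f \<in> E" for f
    using nn_edge[OF that] inP_edge[OF that] by (intro dilate_add[OF convex]) auto
  then have "x' \<in> dilate T ?P"
    unfolding x'_def T_def using inP nn nn_edge
    by (intro dilate_add[OF convex] dilate_sum[OF convex]) (auto intro!: sum_nonneg add_nonneg_nonneg)
  \<comment> \<open>Points of the polytope have coordinate sum 1, so the scale \<open>T\<close> can
    be read off from the coordinate sum of \<open>x\<close>.\<close>
  moreover from this obtain y where "y \<in> ?P" "x' = T *\<^sub>R y" by auto
  then have "(\<Sum>i\<in>UNIV. x $ i) = T"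
    using cosmological_polytope_subset_region[of E ends]
    by (auto simp: xx' region_def sum_distrib_left[symmetric])
  then have "T = s" using x by (simp add: region_def)
  ultimately show ?thesis using xx' by simp
qed

lemma dilate_cosmological_polytope:
  assumes "0 \<le> s"
  shows "dilate s (cosmological_polytope E ends) = region E ends s"
proof (intro equalityI subsetI)
  fix x assume "x \<in> dilate s (cosmological_polytope E ends)"
  then obtain y where y: "y \<in> region E ends 1" "x = s *\<^sub>R y"
    using cosmological_polytope_subset_region[of E ends] by blast
  then show "x \<in> region E ends s" using region_combine[OF y(1) y(1) assms order_refl] by simp
qed (rule region_subset_dilate)

section \<open>Dimension of the polytope\<close>

text \<open>The unit vectors of the vertices and of the edges in \<open>E\<close> are generators and
  affinely independent. The remaining generators combine them with coefficients 1, 1 and -1, which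
  sum to 1.\<close>

lemma aff_dim_cosmological_polytope:
  fixes ends :: "'e::finite \<Rightarrow> 'v::finite \<times> 'v"
  shows "aff_dim (cosmological_polytope E ends) = int (CARD('v) + card E) - 1"
proof -
  let ?I = "range Inl \<union> Inr ` E :: ('v + 'e) set"
  let ?B = "unitv ` ?I"
  have inj: "inj (unitv :: 'v + 'e \<Rightarrow> real ^ ('v + 'e))"
  proof (rule injI)
    fix i j :: "'v + 'e" assume "(unitv i :: real ^ ('v + 'e)) = unitv j"
    then have "(unitv i :: real ^ ('v + 'e)) $ i = unitv j $ i" by simp
    then show "i = j" by (simp split: if_splits)
  qed
  have unitv_axis: "unitv i = axis i 1" for i :: "'v + 'e"
    by (simp add: unitv_def axis_def)
  have "?B \<subseteq> Basis" by (auto simp: unitv_axis axis_in_Basis_iff)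
  then have "independent ?B" using independent_Basis independent_mono by blast
  then have ind: "\<not> affine_dependent ?B" using affine_dependent_imp_dependent by blast
  have "card ?B = card ?I" using inj by (meson card_image inj_on_subset subset_UNIV)
  also have "\<dots> = CARD('v) + card E"
    by (subst card_Un_disjoint) (auto simp: card_image)
  finally have card: "card ?B = CARD('v) + card E" .
  have sub: "?B \<subseteq> cosmo_points E ends" by (auto simp: cosmo_points_def Let_def)
  have hull: "x \<in> affine hull ?B" if "x \<in> ?B" for x using that by (rule hull_inc)
  have "cosmo_points E ends \<subseteq> affine hull ?B"
  proof -
    have "unitv (Inl u) + unitv (Inl v) - unitv (Inr f) \<in> affine hull ?B"
      "unitv (Inl u) - unitv (Inl v) + unitv (Inr f) \<in> affine hull ?B"
      "- unitv (Inl u) + unitv (Inl v) + unitv (Inr f) \<in> affine hull ?B" if "f \<in> E" for u v f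
    proof -
      have m: "unitv (Inl u) \<in> affine hull ?B" "unitv (Inl v) \<in> affine hull ?B" "unitv (Inr f) \<in> affine hull ?B"
        using that by (auto intro!: hull)
      show "unitv (Inl u) + unitv (Inl v) - unitv (Inr f) \<in> affine hull ?B"
        using mem_affine_3[OF affine_affine_hull m, of 1 1 "-1"] by simp
      show "unitv (Inl u) - unitv (Inl v) + unitv (Inr f) \<in> affine hull ?B"
        using mem_affine_3[OF affine_affine_hull m, of 1 "-1" 1] by simp
      show "- unitv (Inl u) + unitv (Inl v) + unitv (Inr f) \<in> affine hull ?B"
        using mem_affine_3[OF affine_affine_hull m, of "-1" 1 1] by simp
    qed
    then show ?thesis using hull by (auto simp: cosmo_points_def Let_def)
  qed
  then have "aff_dim (cosmo_points E ends) = aff_dim ?B"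
    using sub by (metis aff_dim_affine_hull aff_dim_subset order_antisym)
  also have "\<dots> = int (card ?B) - 1" using aff_dim_affine_independent[OF ind] by linarith
  finally show ?thesis by (simp add: cosmological_polytope_def aff_dim_convex_hull card)
qed

section \<open>Lattice points of the dilates\<close>

definition lattice_vec :: "('e \<Rightarrow> int) \<Rightarrow> ('v \<Rightarrow> int) \<Rightarrow> real ^ ('v::finite + 'e::finite)" where
  "lattice_vec c y = (\<chi> i. case i of Inl u \<Rightarrow> of_int (y u) | Inr f \<Rightarrow> of_int (c f))"

lemma lattice_vec_nth [simp]:
  "lattice_vec c y $ Inl u = of_int (y u)" "lattice_vec c y $ Inr f = of_int (c f)"
  by (simp_all add: lattice_vec_def)

lemma sum_UNIV_Plus:
  fixes x :: "real ^ ('v::finite + 'e::finite)"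
  shows "(\<Sum>i\<in>UNIV. x $ i) = (\<Sum>u\<in>UNIV. x $ Inl u) + (\<Sum>f\<in>UNIV. x $ Inr f)"
  unfolding UNIV_Plus_UNIV[symmetric] by (subst sum.Plus) auto

text \<open>Passing from \<open>y\<close> to \<open>D\<close> adds an integral vector that depends
  on \<open>c\<close> only. This shear preserves integrality, so the real conditions become the
  integral ones.\<close>

lemma lattice_vec_in_region_iff:
  fixes ends :: "'e::finite \<Rightarrow> 'v::finite \<times> 'v"
  shows "lattice_vec c y \<in> region E ends (real j) \<longleftrightarrow>
    c \<in> edge_configs E j \<and>
    (\<lambda>u. y u + lift_load E ends c u) \<in> configs UNIV E ends (\<lambda>f. 2 * max (c f) 0) (int j + sum c E)"
    (is "_ \<longleftrightarrow> _ \<and> ?D \<in> configs _ _ _ ?N _")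
proof (cases "\<forall>f. f \<notin> E \<longrightarrow> c f = 0")
  case c: True
  have load: "lift_load E ends (\<lambda>f. real_of_int (c f)) u = of_int (lift_load E ends c u)" for u
    by (simp add: load_def)
  have N: "2 * max (real_of_int (c f)) 0 = of_int (?N f)" for f
    by (simp add: max_def)
  have dom: "dominates UNIV E ends (\<lambda>f. 2 * max (lattice_vec c y $ Inr f) 0)
      (\<lambda>u. lattice_vec c y $ Inl u + lift_load E ends (\<lambda>f. lattice_vec c y $ Inr f) u)
    \<longleftrightarrow> dominates UNIV E ends ?N ?D"
    unfolding lattice_vec_nth load N dominates_def of_int_add[symmetric] of_int_sum[symmetric] of_int_le_iff ..
  have "sum c UNIV = sum c E" using c by (intro sum.mono_neutral_right) auto
  then have "(\<Sum>i\<in>UNIV. lattice_vec c y $ i) = real j \<longleftrightarrow> real_of_int (sum y UNIV + sum c E) = of_int (int j)"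
    by (simp add: sum_UNIV_Plus flip: of_int_sum)
  also have "\<dots> \<longleftrightarrow> sum y UNIV + sum c E = int j" by (rule of_int_eq_iff)
  also have "\<dots> \<longleftrightarrow> sum ?D UNIV = int j + sum c E"
    by (auto simp: sum.distrib sum_load sum_distrib_left[symmetric])
  finally have total: "(\<Sum>i\<in>UNIV. lattice_vec c y $ i) = real j \<longleftrightarrow> sum ?D UNIV = int j + sum c E" .
  \<comment> \<open>The inequality for the whole vertex set, combined with
    \<open>2 * max t 0 = \<bar>t\<bar> + t\<close>.\<close>
  have "(\<Sum>f\<in>E. \<bar>c f\<bar>) \<le> int j" if "dominates UNIV E ends ?N ?D" "sum ?D UNIV = int j + sum c E"
  proof -
    have "inner_edges E ends UNIV = E" by (auto simp: inner_edges_def)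
    then have "sum ?N E \<le> int j + sum c E" using that unfolding dominates_def by (metis subset_UNIV)
    moreover have "sum ?N E = (\<Sum>f\<in>E. \<bar>c f\<bar>) + sum c E"
      unfolding sum.distrib[symmetric] by (rule sum.cong) auto
    ultimately show ?thesis by simp
  qed
  then show ?thesis
    using c dom total by (auto simp: region_def edge_configs_def configs_def)
qed (auto simp: region_def edge_configs_def)

lemma card_lattice_points_dilate:
  fixes ends :: "'e::finite \<Rightarrow> 'v::finite \<times> 'v"
  shows "card (lattice_points (dilate (real j) (cosmological_polytope E ends))) = config_count UNIV E ends j"
proof -
  let ?S = "SIGMA c:edge_configs E j. configs UNIV E ends (\<lambda>f. 2 * max (c f) 0) (int j + sum c E)"
  let ?g = "\<lambda>(c, D). lattice_vec c (\<lambda>u. D u - lift_load E ends c u)"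
  have "bij_betw ?g ?S (lattice_points (dilate (real j) (cosmological_polytope E ends)))"
  proof (rule bij_betwI')
    fix p q assume "p \<in> ?S" "q \<in> ?S"
    obtain c D c' D' where pq: "p = (c, D)" "q = (c', D')" by fastforce
    show "?g p = ?g q \<longleftrightarrow> p = q"
    proof
      assume eq: "?g p = ?g q"
      have "c f = c' f" for f using arg_cong[OF eq, of "\<lambda>x. x $ Inr f"] pq by simp
      then have "c = c'" by auto
      moreover have "D u = D' u" for u using arg_cong[OF eq, of "\<lambda>x. x $ Inl u"] pq \<open>c = c'\<close> by simp
      ultimately show "p = q" using pq by auto
    qed simp
  next
    fix p assume "p \<in> ?S"
    then obtain c D where p: "p = (c, D)" "c \<in> edge_configs E j"
      "D \<in> configs UNIV E ends (\<lambda>f. 2 * max (c f) 0) (int j + sum c E)" by blast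
    then have "?g p \<in> region E ends (real j)" by (simp add: lattice_vec_in_region_iff)
    moreover have "?g p $ i \<in> \<int>" for i by (cases i) (auto simp: p)
    ultimately show "?g p \<in> lattice_points (dilate (real j) (cosmological_polytope E ends))"
      by (simp add: lattice_points_def dilate_cosmological_polytope)
  next
    fix x assume "x \<in> lattice_points (dilate (real j) (cosmological_polytope E ends))"
    then have x: "x \<in> region E ends (real j)" "\<And>i. x $ i \<in> \<int>"
      by (simp_all add: lattice_points_def dilate_cosmological_polytope)
    define c where "c f = \<lfloor>x $ Inr f\<rfloor>" for f
    define y where "y u = \<lfloor>x $ Inl u\<rfloor>" for u
    have "x $ i = lattice_vec c y $ i" for i
      using x(2)[of i] by (cases i) (auto simp: c_def y_def elim: Ints_cases)
    then have xcy: "x = lattice_vec c y" by (simp add: vec_eq_iff)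
    then have "(c, \<lambda>u. y u + lift_load E ends c u) \<in> ?S"
      using x(1) by (simp add: lattice_vec_in_region_iff)
    then show "\<exists>p\<in>?S. x = ?g p" using xcy by (intro bexI[of _ "(c, \<lambda>u. y u + lift_load E ends c u)"]) auto
  qed
  then have "card (lattice_points (dilate (real j) (cosmological_polytope E ends))) = card ?S"
    by (rule bij_betw_same_card[symmetric])
  also have "\<dots> = config_count UNIV E ends j"
    unfolding config_count_def
    by (rule card_SigmaI) (auto intro!: finite_edge_configs finite_configs)
  finally show ?thesis .
qed

lemma h_star_cosmological_polytope:
  fixes ends :: "'e::finite \<Rightarrow> 'v::finite \<times> 'v"
  shows "h_star (cosmological_polytope E ends) = forest_sum UNIV E ends"
proof -
  have "ehrhart_series (cosmological_polytope E ends) = config_fps UNIV E ends"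
    by (simp add: ehrhart_series_def config_fps_def card_lattice_points_dilate)
  moreover have "nat (aff_dim (cosmological_polytope E ends) + 1) = CARD('v) + card E"
    by (simp add: aff_dim_cosmological_polytope)
  ultimately show ?thesis
    using config_fps_eq_forest_sum[of E "UNIV :: 'v set" ends] by (simp add: h_star_def)
qed

section \<open>The Tutte evaluation\<close>

text \<open>The second factor is a power of 0, hence 1 exactly when its exponent is 0. As
  \<open>nat\<close> subtraction truncates, the bound \<open>card_le_comps_plus_card\<close> is what
  confines this to forests; for them the other exponent is the rank minus
  \<open>card H\<close>.\<close>

lemma tutte_at_1:
  fixes ends :: "'e::finite \<Rightarrow> 'v::finite \<times> 'v" and x :: "'a::field"
  shows "tutte E ends x 1 = (\<Sum>H | H \<subseteq> E \<and> comps UNIV ends H + card H = CARD('v).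
    (x - 1) ^ (graph_rank E ends - card H))"
proof -
  have "(x - 1) ^ (num_components ends H - num_components ends E)
      * (1 - 1) ^ (num_components ends H + card H - CARD('v))
    = (if comps UNIV ends H + card H = CARD('v) then (x - 1) ^ (graph_rank E ends - card H) else 0)" for H
  proof -
    have "CARD('v) \<le> comps UNIV ends H + card H" by (rule card_le_comps_plus_card) auto
    moreover have "comps UNIV ends H - comps UNIV ends E = CARD('v) - comps UNIV ends E - card H"
      if "comps UNIV ends H + card H = CARD('v)"
      using that by linarith
    ultimately show ?thesis
      by (auto simp: num_components_eq_comps graph_rank_def power_0_left)
  qed
  then have "tutte E ends x 1 = (\<Sum>H\<in>Pow E.
      if comps UNIV ends H + card H = CARD('v) then (x - 1) ^ (graph_rank E ends - card H) else 0)"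
    by (simp add: tutte_def)
  also have "\<dots> = (\<Sum>H | H \<in> Pow E \<and> comps UNIV ends H + card H = CARD('v). (x - 1) ^ (graph_rank E ends - card H))"
    by (rule sum.inter_filter[symmetric]) simp
  finally show ?thesis by (simp only: Pow_iff)
qed

lemma fps_to_fls_sum: "fps_to_fls (sum g A) = (\<Sum>x\<in>A. fps_to_fls (g x))"
  by (induction A rule: infinite_finite_induct) auto

theorem mainTheorem13:
  fixes E :: "'e::finite set" and ends :: "'e \<Rightarrow> 'v::finite \<times> 'v"
  shows "fps_to_fls (h_star (cosmological_polytope E ends)) =
           (1 + fls_X) ^ (card E - graph_rank E ends) * (2 * fls_X) ^ graph_rank E ends
         * tutte E ends ((1 + 3 * fls_X) / (2 * fls_X)) (1 :: real fls)"
proof -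
  let ?X = "fls_X :: real fls" and ?r = "graph_rank E ends"
  have X: "2 * ?X \<noteq> 0" by simp
  have ratio: "(1 + 3 * ?X) / (2 * ?X) - 1 = (1 + ?X) / (2 * ?X)"
    using X by (simp add: field_simps)
  have "CARD('v) \<le> comps UNIV ends E + card E" by (rule card_le_comps_plus_card) auto
  then have r: "?r \<le> card E" by (auto simp: graph_rank_def num_components_eq_comps)
  \<comment> \<open>Of \<open>(2z)^r\<close> the power \<open>r - |H|\<close> cancels against the
    denominators and \<open>(2z)^|H|\<close> remains, while the exponents of \<open>1 + z\<close>
    add up to \<open>m - |H|\<close>.\<close>
  have term_eq: "(1 + ?X) ^ (card E - ?r) * (2 * ?X) ^ ?r * ((1 + ?X) / (2 * ?X)) ^ (?r - card H)
    = (2 * ?X) ^ card H * (1 + ?X) ^ (card E - card H)"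
    if H: "H \<subseteq> E" "comps UNIV ends H + card H = CARD('v)" for H
  proof -
    \<comment> \<open>A forest has at most \<open>r\<close> edges, so the truncated difference
      \<open>r - |H|\<close> is a true one.\<close>
    have "comps UNIV ends E \<le> comps UNIV ends H" by (rule comps_antimono) (use H in auto)
    then have Hr: "card H \<le> ?r" using H by (auto simp: graph_rank_def num_components_eq_comps)
    have "(2 * ?X) ^ ?r = (2 * ?X) ^ card H * (2 * ?X) ^ (?r - card H)"
      by (subst power_add[symmetric]) (use Hr in simp)
    moreover have "(1 + ?X) ^ (card E - card H) = (1 + ?X) ^ (card E - ?r) * (1 + ?X) ^ (?r - card H)"
      by (subst power_add[symmetric]) (use Hr r in simp)
    ultimately show ?thesis using X by (simp only: power_divide) (simp add: field_simps)
  qed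
  have "fps_to_fls (h_star (cosmological_polytope E ends)) =
    (\<Sum>H | H \<subseteq> E \<and> comps UNIV ends H + card H = CARD('v). (2 * ?X) ^ card H * (1 + ?X) ^ (card E - card H))"
    by (simp add: h_star_cosmological_polytope forest_sum_def fps_to_fls_sum fls_times_fps_to_fls
        fps_to_fls_power)
  also have "\<dots> = (1 + ?X) ^ (card E - ?r) * (2 * ?X) ^ ?r * tutte E ends ((1 + 3 * ?X) / (2 * ?X)) 1"
    unfolding tutte_at_1 ratio sum_distrib_left by (rule sum.cong) (simp_all only: term_eq mem_Collect_eq)
  finally show ?thesis .
qed

end
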